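(* Let $\alpha\in(0,2]$, $\beta\in(0,1)$, $\nu>0$, let $d\ge1$ be an integer with $d<\min\{2,\beta^{-1}\}\alpha$, and let $u_0:\mathbb{R}^d\to\mathbb{R}$ be measurable and bounded with $\inf_{x\in\mathbb{R}^d}u_0(x)>0$. Suppose there exist constants $L>0$, $\rho>1$, $\kappa>0$ and a positive function $\overline J$ on $\mathbb{R}^d$ such that $|\sigma(x,h)|\ge L\overline J(h)|x|^\rho$ for all $x\in\mathbb{R}$, $h\in\mathbb{R}^d$, and $\int_{\mathbb{R}^d}\overline J(h)^2\mu(dh)\ge\kappa$. Then there is no finite energy solution to $$\frac{\partial^\beta u}{\partial t^\beta}+\nu(-\Delta)^{\alpha/2}u=I_t^{1-\beta}\Big[\int_{\mathbb{R}^d}\sigma(u(t,x),h)\,\dot{\tilde N}(t,x,h)\Big]$$ with initial condition $u_0$.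
   Context: Noise: $\mu$ is a Lévy measure on $\mathbb{R}^d$, i.e. $\int_{\mathbb{R}^d}(1\wedge|h|^2)\mu(dh)<\infty$. $N$ is a Poisson random measure on $\mathbb{R}_+\times\mathbb{R}^d\times\mathbb{R}^d$ with intensity $dt\,dx\,\mu(dh)$, and $\tilde N(ds\,dx\,dh)=N(ds\,dx\,dh)-ds\,dx\,\mu(dh)$. Predictability is with respect to the filtration $(\mathcal{F}_t)$ generated by $N$. For predictable $X$ with $\int_0^T\int\int \mathbb{E}|X(s,x,h)|^2\,ds\,dx\,\mu(dh)<\infty$, the integral $\int_0^T\int\int X\,d\tilde N$ is defined and satisfies $\mathbb{E}|\int X\,d\tilde N|^2=\int_0^T\int\int\mathbb{E}X^2\,ds\,dx\,\mu(dh)$. The function $\sigma:\mathbb{R}\times\mathbb{R}^d\to\mathbb{R}$ is jointly measurable. Kernel: $G_t(x)=G(t,x)=\int_0^\infty p_{X(s)}(x)f_{E_t}(s)\,ds$, where $p_{X(s)}$ is the density with Fourier transform $\widehat{p_{X(s)}}(\xi)=e^{-s\nu|\xi|^\alpha}$ (isotropic $\alpha$-stable process on $\mathbb{R}^d$) and $f_{E_t}(s)=t\beta^{-1}s^{-1-1/\beta}g_\beta(ts^{-1/\beta})$ is the density of the inverse $\beta$-stable subordinator $E_t$, $g_\beta$ being the density of $D_1$ for the $\beta$-stable subordinator $D$ with $\mathbb{E}e^{-\lambda D_1}=e^{-\lambda^\beta}$. It is the fundamental solution of $\partial_t^\beta G_t=-\nu(-\Delta)^{\alpha/2}G_t$ (Caputo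 derivative). The equation is interpreted in the mild sense. A (predictable) random field $\{u(t,x)\}_{t>0,x\in\mathbb{R}^d}$ is a mild solution with initial condition $u_0$ if, for all $t,x$, a.s., $$u(t,x)=\int_{\mathbb{R}^d}G(t,x-y)u_0(y)\,dy+\int_0^t\int_{\mathbb{R}^d}\int_{\mathbb{R}^d}G(t-s,x-y)\sigma(u(s,y),h)\,\tilde N(ds\,dy\,dh),$$ the stochastic integrand being square integrable in the sense that $\int_0^t\int_{\mathbb{R}^d}\int_{\mathbb{R}^d}G(t-s,x-y)^2\,\mathbb{E}|\sigma(u(s,y),h)|^2\,ds\,dy\,\mu(dh)<\infty$. For $\gamma>0$ let $\|u\|_{2,\gamma}:=\{\sup_{t>0}\sup_{x\in\mathbb{R}^d}e^{-\gamma t}\mathbb{E}|u(t,x)|^2\}^{1/2}$, and let $\mathcal{L}^{\gamma,2}$ be the completion in this norm of the simple random fields, i.e. finite sums of elementary fields $X1_{(a,b]}(t)\phi(x)$ with disjoint supports, where $0\le a\le b<\infty$, $X\in L^2(\Omega)$ is $\mathcal{F}_a$-measurable and $\phi$ is non-random, bounded and measurable. A finite energy solution is a mild solution $u\in\bigcup_{\gamma>0}\mathcal{L}^{\gamma,2}$ for which there exists $\rho_*>0$ with $\int_0^\infty e^{-\rho_*t}\,\mathbb{E}(|u(t,x)|^2)\,dt<\infty$ for all $x\in\mathbb{R}^d$. *)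

theory Defs
  imports "HOL-Probability.Probability"
begin

text \<open>
  The state space of dimension d is a type \<open>'d\<close> of class \<open>euclidean_space\<close>, with d = \<open>DIM('d)\<close>.
  Random fields take their arguments in the order time, space (, jump size), sample point.
\<close>

section \<open>The noise\<close>

text \<open>
  \<sigma>-finiteness, needed for the product intensity, follows from the integrability condition
  except for a possible atom of infinite mass at 0. In particular the usual
  convention \<open>mu {0} = 0\<close> is covered, but it is not imposed.
\<close>

definition levy_measure :: "'d::euclidean_space measure \<Rightarrow> bool" where
  "levy_measure mu \<longleftrightarrow>
     sets mu = sets borel \<and> sigma_finite_measure mu \<and>
     (\<integral>\<^sup>+h. ennreal (min 1 ((norm h)\<^sup>2)) \<partial>mu) < \<infinity>"

definition intensity :: "'d::euclidean_space measure \<Rightarrow> (real \<times> 'd \<times> 'd) measure" where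
  "intensity mu = restrict_space lborel {0..} \<Otimes>\<^sub>M lborel \<Otimes>\<^sub>M mu"

text \<open>
  The Poisson weights are written out because \<open>poisson_pmf\<close> requires a strictly positive rate.
\<close>

definition poisson_random_measure ::
  "'w measure \<Rightarrow> 'a measure \<Rightarrow> ('w \<Rightarrow> 'a measure) \<Rightarrow> bool" where
  "poisson_random_measure M m N \<longleftrightarrow>
     (\<forall>\<omega>\<in>space M. space (N \<omega>) = space m \<and> sets (N \<omega>) = sets m) \<and>
     (\<forall>A\<in>sets m. (\<lambda>\<omega>. emeasure (N \<omega>) A) \<in> borel_measurable M) \<and>
     (\<forall>A\<in>sets m. emeasure m A < \<infinity> \<longrightarrow>
        (\<forall>k::nat. measure M {\<omega>\<in>space M. emeasure (N \<omega>) A = of_nat k} =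
           exp (- measure m A) * measure m A ^ k / fact k)) \<and>
     (\<forall>A\<in>sets m. emeasure m A = \<infinity> \<longrightarrow> (AE \<omega> in M. emeasure (N \<omega>) A = \<infinity>)) \<and>
     (\<forall>(n::nat) A. (\<forall>i<n. A i \<in> sets m) \<and> disjoint_family_on A {..<n} \<longrightarrow>
        prob_space.indep_vars M (\<lambda>_. borel) (\<lambda>i \<omega>. emeasure (N \<omega>) (A i)) {..<n})"

definition compensated ::
  "'a measure \<Rightarrow> ('w \<Rightarrow> 'a measure) \<Rightarrow> 'a set \<Rightarrow> 'w \<Rightarrow> real" where
  "compensated m N A \<omega> = measure (N \<omega>) A - measure m A"

definition noise_filtration ::
  "'w measure \<Rightarrow> 'd::euclidean_space measure \<Rightarrow> ('w \<Rightarrow> (real \<times> 'd \<times> 'd) measure)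
    \<Rightarrow> real \<Rightarrow> 'w measure" where
  "noise_filtration M mu N t = sigma (space M)
     {(\<lambda>\<omega>. emeasure (N \<omega>) A) -` B \<inter> space M | A B.
        A \<in> sets (intensity mu) \<and> A \<subseteq> {0..t} \<times> UNIV \<and> B \<in> sets borel}"

definition predictable_algebra ::
  "'w measure \<Rightarrow> 'd::euclidean_space measure \<Rightarrow> ('w \<Rightarrow> (real \<times> 'd \<times> 'd) measure)
    \<Rightarrow> ('w \<times> real) measure" where
  "predictable_algebra M mu N = sigma (space M \<times> {0<..})
     {F \<times> {a<..b} | F a b. 0 \<le> a \<and> a \<le> b \<and> F \<in> sets (noise_filtration M mu N a)}"

definition predictable_field ::
  "'w measure \<Rightarrow> 'd::euclidean_space measure \<Rightarrow> ('w \<Rightarrow> (real \<times> 'd \<times> 'd) measure)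
    \<Rightarrow> (real \<Rightarrow> 'd \<Rightarrow> 'w \<Rightarrow> real) \<Rightarrow> bool" where
  "predictable_field M mu N u \<longleftrightarrow>
     (\<lambda>((\<omega>, t), x). u t x \<omega>) \<in> borel_measurable (predictable_algebra M mu N \<Otimes>\<^sub>M borel)"

definition predictable_integrand ::
  "'w measure \<Rightarrow> 'd::euclidean_space measure \<Rightarrow> ('w \<Rightarrow> (real \<times> 'd \<times> 'd) measure)
    \<Rightarrow> (real \<Rightarrow> 'd \<Rightarrow> 'd \<Rightarrow> 'w \<Rightarrow> real) \<Rightarrow> bool" where
  "predictable_integrand M mu N X \<longleftrightarrow>
     (\<lambda>((\<omega>, s), x, h). X s x h \<omega>)
       \<in> borel_measurable (predictable_algebra M mu N \<Otimes>\<^sub>M borel \<Otimes>\<^sub>M borel)"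

section \<open>The stochastic integral\<close>

definition integrand_sq_norm ::
  "'w measure \<Rightarrow> 'd::euclidean_space measure \<Rightarrow> real
    \<Rightarrow> (real \<Rightarrow> 'd \<Rightarrow> 'd \<Rightarrow> 'w \<Rightarrow> real) \<Rightarrow> ennreal" where
  "integrand_sq_norm M mu T X =
     (\<integral>\<^sup>+s\<in>{0<..T}. (\<integral>\<^sup>+x. (\<integral>\<^sup>+h. (\<integral>\<^sup>+\<omega>. ennreal ((X s x h \<omega>)\<^sup>2) \<partial>M) \<partial>mu) \<partial>lborel) \<partial>lborel)"

text \<open>\<open>simple_integral M mu N T S J\<close>: \<open>S\<close> is a simple predictable integrand on (0,T] and \<open>J\<close> its
  integral with respect to the compensated measure.\<close>

definition simple_integral ::
  "'w measure \<Rightarrow> 'd::euclidean_space measure \<Rightarrow> ('w \<Rightarrow> (real \<times> 'd \<times> 'd) measure) \<Rightarrow> real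
    \<Rightarrow> (real \<Rightarrow> 'd \<Rightarrow> 'd \<Rightarrow> 'w \<Rightarrow> real) \<Rightarrow> ('w \<Rightarrow> real) \<Rightarrow> bool" where
  "simple_integral M mu N T S J \<longleftrightarrow>
     (\<exists>(n::nat) Y a b B.
        (\<forall>i<n. 0 \<le> a i \<and> a i \<le> b i \<and> b i \<le> T \<and>
               Y i \<in> borel_measurable (noise_filtration M mu N (a i)) \<and>
               bounded (Y i ` space M) \<and>
               B i \<in> sets (lborel \<Otimes>\<^sub>M mu) \<and> emeasure (lborel \<Otimes>\<^sub>M mu) (B i) < \<infinity>) \<and>
        S = (\<lambda>s x h \<omega>. \<Sum>i<n. Y i \<omega> * indicator {a i<..b i} s * indicator (B i) (x, h)) \<and>
        J = (\<lambda>\<omega>. \<Sum>i<n. Y i \<omega> * compensated (intensity mu) N ({a i<..b i} \<times> B i) \<omega>))"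

text \<open>The integral over (0,T] is the extension of the integral of simple integrands by the
  \<open>L\<^sup>2\<close>-isometry; being defined only almost surely, it is rendered as a relation.\<close>

definition has_compensated_integral ::
  "'w measure \<Rightarrow> 'd::euclidean_space measure \<Rightarrow> ('w \<Rightarrow> (real \<times> 'd \<times> 'd) measure) \<Rightarrow> real
    \<Rightarrow> (real \<Rightarrow> 'd \<Rightarrow> 'd \<Rightarrow> 'w \<Rightarrow> real) \<Rightarrow> ('w \<Rightarrow> real) \<Rightarrow> bool" where
  "has_compensated_integral M mu N T X I \<longleftrightarrow>
     predictable_integrand M mu N X \<and> integrand_sq_norm M mu T X < \<infinity> \<and>
     I \<in> borel_measurable M \<and>
     (\<exists>S J. (\<forall>k::nat. simple_integral M mu N T (S k) (J k)) \<and>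
        (\<lambda>k. integrand_sq_norm M mu T (\<lambda>s x h \<omega>. S k s x h \<omega> - X s x h \<omega>)) \<longlonglongrightarrow> 0 \<and>
        (\<lambda>k. \<integral>\<^sup>+\<omega>. ennreal ((J k \<omega> - I \<omega>)\<^sup>2) \<partial>M) \<longlonglongrightarrow> 0)"

section \<open>The kernel\<close>

text \<open>\<open>p s\<close> is the density with Fourier transform \<open>exp (- s * nu * |xi| powr alpha)\<close>. A density is
  determined only up to null sets; the jointly continuous version is meant. (Integrability of
  \<open>p s\<close> and total mass 1 are the case \<open>xi = 0\<close>, as the Bochner integral of a non-integrable
  function is 0.)\<close>

definition stable_density ::
  "real \<Rightarrow> real \<Rightarrow> (real \<Rightarrow> 'd::euclidean_space \<Rightarrow> real) \<Rightarrow> bool" where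
  "stable_density \<nu> \<alpha> p \<longleftrightarrow>
     continuous_on ({0<..} \<times> UNIV) (\<lambda>(s, x). p s x) \<and>
     (\<forall>s>0. (\<forall>x. 0 \<le> p s x) \<and>
        (\<forall>\<xi>. (LINT x|lborel. cis (- (\<xi> \<bullet> x)) * complex_of_real (p s x)) =
              complex_of_real (exp (- s * \<nu> * norm \<xi> powr \<alpha>))))"

text \<open>\<open>g\<close> is the density of \<open>D\<^sub>1\<close> for the beta-stable subordinator \<open>D\<close>; the case
  \<open>q = 0\<close> says that the total mass is 1.\<close>

definition subordinator_density :: "real \<Rightarrow> (real \<Rightarrow> real) \<Rightarrow> bool" where
  "subordinator_density \<beta> g \<longleftrightarrow>
     g \<in> borel_measurable borel \<and> (\<forall>r. 0 \<le> g r) \<and> (\<forall>r\<le>0. g r = 0) \<and>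
     (\<forall>q\<ge>0. (LINT r|lborel. exp (- q * r) * g r) = exp (- (q powr \<beta>)))"

definition inverse_subordinator_density :: "real \<Rightarrow> (real \<Rightarrow> real) \<Rightarrow> real \<Rightarrow> real \<Rightarrow> real" where
  "inverse_subordinator_density \<beta> g t s =
     t * (1 / \<beta>) * s powr (- 1 - 1 / \<beta>) * g (t * s powr (- 1 / \<beta>))"

text \<open>For \<open>t > 0\<close> the integral can diverge only for \<open>x\<close> in a null set (at \<open>x = 0\<close>), where the value is
  then 0 instead of infinity; \<open>G\<close> is only ever used under integrals over space. By
  \<open>g r = 0\<close> for \<open>r \<le> 0\<close> it vanishes for \<open>t \<le> 0\<close>.\<close>

definition kernel ::
  "real \<Rightarrow> (real \<Rightarrow> 'd::euclidean_space \<Rightarrow> real) \<Rightarrow> (real \<Rightarrow> real) \<Rightarrow> real \<Rightarrow> 'd \<Rightarrow> real" where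
  "kernel \<beta> p g t x = (LINT s:{0<..}|lborel. p s x * inverse_subordinator_density \<beta> g t s)"

section \<open>Solutions\<close>

definition mild_solution ::
  "'w measure \<Rightarrow> 'd::euclidean_space measure \<Rightarrow> ('w \<Rightarrow> (real \<times> 'd \<times> 'd) measure)
    \<Rightarrow> (real \<Rightarrow> 'd \<Rightarrow> real) \<Rightarrow> (real \<Rightarrow> 'd \<Rightarrow> real) \<Rightarrow> ('d \<Rightarrow> real)
    \<Rightarrow> (real \<Rightarrow> 'd \<Rightarrow> 'w \<Rightarrow> real) \<Rightarrow> bool" where
  "mild_solution M mu N G \<sigma> u0 u \<longleftrightarrow>
     predictable_field M mu N u \<and>
     (\<forall>t>0. \<forall>x.
        (\<integral>\<^sup>+s\<in>{0<..t}. (\<integral>\<^sup>+y. (\<integral>\<^sup>+h.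
            ennreal ((G (t - s) (x - y))\<^sup>2) * (\<integral>\<^sup>+\<omega>. ennreal (\<bar>\<sigma> (u s y \<omega>) h\<bar>\<^sup>2) \<partial>M)
          \<partial>mu) \<partial>lborel) \<partial>lborel) < \<infinity> \<and>
        (\<exists>I. has_compensated_integral M mu N t
               (\<lambda>s y h \<omega>. G (t - s) (x - y) * \<sigma> (u s y \<omega>) h) I \<and>
             (AE \<omega> in M. u t x \<omega> = (LINT y|lborel. G t (x - y) * u0 y) + I \<omega>)))"

definition field_norm ::
  "'w measure \<Rightarrow> real \<Rightarrow> (real \<Rightarrow> 'd::euclidean_space \<Rightarrow> 'w \<Rightarrow> real) \<Rightarrow> ennreal" where
  "field_norm M \<gamma> u =
     (let S = (SUP t\<in>{0<..}. SUP x.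
                 ennreal (exp (- \<gamma> * t)) * (\<integral>\<^sup>+\<omega>. ennreal (\<bar>u t x \<omega>\<bar>\<^sup>2) \<partial>M))
      in if S = \<infinity> then \<infinity> else ennreal (sqrt (enn2real S)))"

definition elementary_field ::
  "'w measure \<Rightarrow> 'd::euclidean_space measure \<Rightarrow> ('w \<Rightarrow> (real \<times> 'd \<times> 'd) measure)
    \<Rightarrow> (real \<Rightarrow> 'd \<Rightarrow> 'w \<Rightarrow> real) \<Rightarrow> bool" where
  "elementary_field M mu N e \<longleftrightarrow>
     (\<exists>a b X \<phi>. 0 \<le> a \<and> a \<le> b \<and>
        X \<in> borel_measurable (noise_filtration M mu N a) \<and> integrable M (\<lambda>\<omega>. (X \<omega>)\<^sup>2) \<and>
        \<phi> \<in> borel_measurable borel \<and> bounded (range \<phi>) \<and>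
        e = (\<lambda>t x \<omega>. X \<omega> * indicator {a<..b} t * \<phi> x))"

text \<open>Disjointness of supports refers to the sets of \<open>(t, x, \<omega>)\<close> where the summands do not vanish.\<close>

definition simple_field ::
  "'w measure \<Rightarrow> 'd::euclidean_space measure \<Rightarrow> ('w \<Rightarrow> (real \<times> 'd \<times> 'd) measure)
    \<Rightarrow> (real \<Rightarrow> 'd \<Rightarrow> 'w \<Rightarrow> real) \<Rightarrow> bool" where
  "simple_field M mu N v \<longleftrightarrow>
     (\<exists>(n::nat) e. (\<forall>i<n. elementary_field M mu N (e i)) \<and>
        (\<forall>i<n. \<forall>j<n. i \<noteq> j \<longrightarrow>
           (\<forall>t x. \<forall>\<omega>\<in>space M. \<not> (e i t x \<omega> \<noteq> 0 \<and> e j t x \<omega> \<noteq> 0))) \<and>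
        v = (\<lambda>t x \<omega>. \<Sum>i<n. e i t x \<omega>))"

text \<open>A Cauchy sequence of simple fields has a limit, namely the \<open>L\<^sup>2\<close>-limit at each \<open>(t, x)\<close>. The
  completion is therefore realised by the fields that are limits of simple fields.\<close>

definition in_field_space ::
  "'w measure \<Rightarrow> 'd::euclidean_space measure \<Rightarrow> ('w \<Rightarrow> (real \<times> 'd \<times> 'd) measure)
    \<Rightarrow> real \<Rightarrow> (real \<Rightarrow> 'd \<Rightarrow> 'w \<Rightarrow> real) \<Rightarrow> bool" where
  "in_field_space M mu N \<gamma> u \<longleftrightarrow>
     (\<forall>t>0. \<forall>x. u t x \<in> borel_measurable M) \<and>
     (\<exists>v. (\<forall>k::nat. simple_field M mu N (v k)) \<and>
        (\<lambda>k. field_norm M \<gamma> (\<lambda>t x \<omega>. v k t x \<omega> - u t x \<omega>)) \<longlonglongrightarrow> 0)"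

definition finite_energy_solution ::
  "'w measure \<Rightarrow> 'd::euclidean_space measure \<Rightarrow> ('w \<Rightarrow> (real \<times> 'd \<times> 'd) measure)
    \<Rightarrow> (real \<Rightarrow> 'd \<Rightarrow> real) \<Rightarrow> (real \<Rightarrow> 'd \<Rightarrow> real) \<Rightarrow> ('d \<Rightarrow> real)
    \<Rightarrow> (real \<Rightarrow> 'd \<Rightarrow> 'w \<Rightarrow> real) \<Rightarrow> bool" where
  "finite_energy_solution M mu N G \<sigma> u0 u \<longleftrightarrow>
     mild_solution M mu N G \<sigma> u0 u \<and>
     (\<exists>\<gamma>>0. in_field_space M mu N \<gamma> u) \<and>
     (\<exists>r>0. \<forall>x. (\<integral>\<^sup>+t\<in>{0<..}. ennreal (exp (- r * t)) *
                      (\<integral>\<^sup>+\<omega>. ennreal (\<bar>u t x \<omega>\<bar>\<^sup>2) \<partial>M) \<partial>lborel) < \<infinity>)"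

end

theory Submission
  imports Defs
begin

text \<open>
  Write \<open>F(t,x) = E |u(t,x)|\<^sup>2\<close> for a mild solution \<open>u\<close>, and \<open>b = \<beta> d / \<alpha> < 1\<close>. By the isometry of the
  stochastic integral, the growth of \<open>\<sigma>\<close> and Jensen's inequality,
  \<open>F(t,x) \<ge> (inf u\<^sub>0)\<^sup>2 + L\<^sup>2 \<kappa> \<integral>\<^sub>0\<^sup>t \<integral> G(t-s,x-y)\<^sup>2 F(s,y) powr \<rho> dy ds\<close>.
  A positive fraction of the mass of \<open>G\<^sub>t\<close> lies in a cube of side of order \<open>t powr (\<beta> / \<alpha>)\<close>, so
  \<open>\<parallel>G\<^sub>t\<parallel>\<^sup>2 \<ge> c t powr (- b)\<close> in \<open>L\<^sup>2\<close> by Cauchy-Schwarz. Hence \<open>F \<ge> A\<close> after time \<open>T\<close> implies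
  \<open>F \<ge> K A powr \<rho> \<delta> powr (1 - b)\<close> after time \<open>T + \<delta>\<close>. A long first step makes the lower bound large,
  and since \<open>\<rho> > 1\<close> it then tends to infinity along steps of length \<open>2 ^ (- n)\<close>. So \<open>F\<close> is infinite
  from some finite time on, which no finite energy solution permits.
\<close>

section \<open>Independence of a Poisson random measure over disjoint sets\<close>

text \<open>The isometry has to be derived: the integral is only a relation, an L2 limit of simple
  integrals, and the noise is known through Poisson laws and independence over finite disjoint
  families. These are strengthened to independence of \<open>N(Q)\<close> from everything outside
  \<open>Q\<close>. The past lies outside every later rectangle, so covariances of simple integrals
  become computable.

  The second moment to be estimated may be infinite, and in the end is shown to be; hence the
  estimates are inequalities in \<open>ennreal\<close>.

  The densities \<open>p s\<close> are known only through Fourier transforms. Their spread is read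
  off coordinate by coordinate, where uniqueness of characteristic functions on the line yields
  self-similarity. The law of \<open>E_t\<close> is, for every \<open>t\<close>, an image of the
  same density \<open>g\<close>, which makes the constants uniform in \<open>t\<close>.

  Positivity of \<open>1 - b\<close> serves the long first step: however small \<open>inf u0\<close>
  is, some step length lifts the bound over the threshold beyond which the gain from
  \<open>\<rho> > 1\<close> outweighs the factors \<open>2 powr (- n * (1 - b))\<close>.\<close>

locale poisson_noise = prob_space M for M :: "'w measure" +
  fixes m :: "'a measure" and N :: "'w \<Rightarrow> 'a measure"
  assumes prm: "poisson_random_measure M m N"
begin

lemma sets_N: "\<omega> \<in> space M \<Longrightarrow> sets (N \<omega>) = sets m"
  using prm by (auto simp: poisson_random_measure_def)

lemma measurable_N [measurable]:
  "A \<in> sets m \<Longrightarrow> (\<lambda>\<omega>. emeasure (N \<omega>) A) \<in> borel_measurable M"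
  using prm by (auto simp: poisson_random_measure_def)

lemma poisson_law:
  "A \<in> sets m \<Longrightarrow> emeasure m A < \<infinity> \<Longrightarrow>
     prob {\<omega>\<in>space M. emeasure (N \<omega>) A = of_nat k} = exp (- measure m A) * measure m A ^ k / fact k"
  using prm by (auto simp: poisson_random_measure_def)

lemma indep_N:
  "(\<And>i. i < n \<Longrightarrow> A i \<in> sets m) \<Longrightarrow> disjoint_family_on A {..<n} \<Longrightarrow>
     indep_vars (\<lambda>_. borel) (\<lambda>i \<omega>. emeasure (N \<omega>) (A i)) {..<n::nat}"
  using prm by (auto simp: poisson_random_measure_def)

text \<open>One parameter covers three uses: all sets missing \<open>Q\<close>, the single set
  \<open>Q\<close>, and the sets in a time slab \<open>{0..t} \<times> UNIV\<close> that generate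
  the filtration.\<close>

definition count_events :: "'a set set \<Rightarrow> 'w set set" where
  "count_events \<A> = {(\<lambda>\<omega>. emeasure (N \<omega>) A) -` B \<inter> space M | A B. A \<in> sets m \<inter> \<A> \<and> B \<in> sets borel}"

text \<open>All information about the noise away from \<open>Q\<close>. It contains the past up to
  \<open>t\<close> as soon as \<open>Q\<close> lies strictly after \<open>t\<close>.\<close>

definition outside :: "'a set \<Rightarrow> 'w measure" where
  "outside Q = sigma (space M) (count_events {A. A \<inter> Q = {}})"

lemma count_events_subset: "count_events \<A> \<subseteq> events"
  by (auto simp: count_events_def intro!: measurable_sets[OF measurable_N])

lemma space_outside [simp]: "space (outside Q) = space M"
  and sets_outside: "sets (outside Q) = sigma_sets (space M) (count_events {A. A \<inter> Q = {}})"
  using count_events_subset[of "{A. A \<inter> Q = {}}"] sets.space_closed[of M]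
  by (auto simp: outside_def)

lemma subalgebra_outside: "sets (outside Q) \<subseteq> events"
  unfolding sets_outside by (rule sets.sigma_sets_subset[OF count_events_subset])

lemma measurable_outside_N:
  assumes "A \<in> sets m" "A \<inter> Q = {}"
  shows "(\<lambda>\<omega>. emeasure (N \<omega>) A) \<in> borel_measurable (outside Q)"
  by (rule measurableI) (use assms in \<open>auto simp: sets_outside count_events_def intro!: sigma_sets.Basic\<close>)

text \<open>Each \<open>N(A\<^sub>i)\<close> is a sum of the values of \<open>N\<close> at the atoms of the finite algebra generated by the
  \<open>A\<^sub>i\<close>, and these atoms together with \<open>Q\<close> are disjoint.\<close>

lemma prob_joint_counts:
  fixes n :: nat
  assumes A: "\<And>i. i < n \<Longrightarrow> A i \<in> sets m" "\<And>i. i < n \<Longrightarrow> A i \<inter> Q = {}"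
    and B: "\<And>i. i < n \<Longrightarrow> B i \<in> sets borel"
    and Q: "Q \<in> sets m" and C: "C \<in> sets borel"
  shows "prob ({\<omega>\<in>space M. \<forall>i<n. emeasure (N \<omega>) (A i) \<in> B i} \<inter> {\<omega>\<in>space M. emeasure (N \<omega>) Q \<in> C})
    = prob {\<omega>\<in>space M. \<forall>i<n. emeasure (N \<omega>) (A i) \<in> B i} * prob {\<omega>\<in>space M. emeasure (N \<omega>) Q \<in> C}"
proof -
  \<comment> \<open>Each subset of the indices names one atom: the points lying in exactly those
    \<open>A i\<close>. The enumeration turns the atoms into a family indexed by natural numbers, as
    the independence property requires.\<close>
  obtain h where h: "bij_betw h {..<card (Pow {..<n})} (Pow {..<n})"
    using ex_bij_betw_nat_finite[of "Pow {..<n}"] by (auto simp: atLeast0LessThan)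
  define k where "k = card (Pow {..<n})"
  define At where "At j = {x\<in>space m. x \<notin> Q \<and> {i. i < n \<and> x \<in> A i} = h j}" for j
  \<comment> \<open>The extra index \<open>k\<close> is reserved for \<open>Q\<close>, so that atoms
    and \<open>Q\<close> form a single disjoint family.\<close>
  define D where "D j = (if j = k then Q else At j)" for j
  have hsub: "h j \<subseteq> {..<n}" if "j < k" for j
    using bij_betwE[OF h] that by (auto simp: k_def)
  have At_alt: "At j = {x\<in>space m. x \<notin> Q \<and> (\<forall>i<n. x \<in> A i \<longleftrightarrow> i \<in> h j)}" if "j < k" for j
    using hsub[OF that] by (auto simp: At_def)
  have At[measurable]: "At j \<in> sets m" if "j < k" for j
    unfolding At_alt[OF that] using A(1) Q by measurable
  have D_sets: "D j \<in> sets m" if "j < Suc k" for j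
    using that Q At by (auto simp: D_def)
  have dis_At: "disjoint_family_on At {..<k}"
    using bij_betw_imp_inj_on[OF h] by (auto simp: disjoint_family_on_def At_def k_def inj_on_def)
  have dis: "disjoint_family_on D {..<Suc k}"
    using dis_At by (auto simp: disjoint_family_on_def D_def At_def)
  have A_eq: "A i = (\<Union>j\<in>{j. j < k \<and> i \<in> h j}. At j)" if "i < n" for i
  proof safe
    fix x assume x: "x \<in> A i"
    have "{i. i < n \<and> x \<in> A i} \<in> h ` {..<k}"
      using h by (auto simp: bij_betw_def k_def)
    then obtain j where "j < k" "h j = {i. i < n \<and> x \<in> A i}" by auto
    moreover have "x \<in> space m" "x \<notin> Q" using x A[OF that] sets.sets_into_space by auto
    ultimately show "x \<in> (\<Union>j\<in>{j. j < k \<and> i \<in> h j}. At j)" using x that by (auto simp: At_def)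
  next
    fix x j assume "x \<in> At j" "i \<in> h j" then show "x \<in> A i" by (auto simp: At_def)
  qed
  let ?v = "\<lambda>\<omega>. \<lambda>j\<in>{..<k}. emeasure (N \<omega>) (D j)"
  let ?w = "\<lambda>\<omega>. \<lambda>j\<in>{k}. emeasure (N \<omega>) (D j)"
  have N_sum: "emeasure (N \<omega>) (A i) = (\<Sum>j\<in>{j. j < k \<and> i \<in> h j}. ?v \<omega> j)"
    if "i < n" "\<omega> \<in> space M" for i \<omega>
  proof -
    have "(\<Sum>j\<in>{j. j < k \<and> i \<in> h j}. emeasure (N \<omega>) (At j)) = emeasure (N \<omega>) (A i)"
      unfolding A_eq[OF that(1)]
    proof (rule sum_emeasure)
      show "disjoint_family_on At {j. j < k \<and> i \<in> h j}"
        by (rule disjoint_family_on_mono[OF _ dis_At]) auto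
    qed (use At sets_N that in auto)
    then show ?thesis by (simp add: D_def)
  qed
  \<comment> \<open>Disjoint blocks of an independent family are independent; the blocks here are
    the atoms and \<open>Q\<close>.\<close>
  have ind: "indep_var (PiM {..<k} (\<lambda>_. borel)) ?v (PiM {k} (\<lambda>_. borel)) ?w"
    by (rule indep_var_restrict[OF indep_N[OF D_sets dis]]) auto
  let ?S = "{v\<in>space (PiM {..<k} (\<lambda>_. borel :: ennreal measure)). \<forall>i<n. (\<Sum>j\<in>{j. j < k \<and> i \<in> h j}. v j) \<in> B i}"
  let ?T = "{v\<in>space (PiM {k} (\<lambda>_. borel :: ennreal measure)). v k \<in> C}"
  have S: "?S \<in> sets (PiM {..<k} (\<lambda>_. borel))" and T: "?T \<in> sets (PiM {k} (\<lambda>_. borel))"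
    using B C by measurable
  have "prob ((?v -` ?S \<inter> space M) \<inter> (?w -` ?T \<inter> space M)) =
    prob (?v -` ?S \<inter> space M) * prob (?w -` ?T \<inter> space M)"
    by (rule indep_setD[OF conjunct2[OF ind[unfolded indep_var_eq]]]; rule sigma_sets.Basic; use S T in blast)
  moreover have "?v -` ?S \<inter> space M = {\<omega>\<in>space M. \<forall>i<n. emeasure (N \<omega>) (A i) \<in> B i}"
    by (auto simp: N_sum space_PiM)
  moreover have "?w -` ?T \<inter> space M = {\<omega>\<in>space M. emeasure (N \<omega>) Q \<in> C}"
    by (auto simp: D_def space_PiM)
  ultimately show ?thesis by simp
qed

text \<open>The generators of \<open>outside Q\<close> need not be closed under intersection. Events
  about finitely many counts are, they satisfy the product rule by \<open>prob_joint_counts\<close>,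
  and independence passes from intersection-stable families to the generated sigma-algebras.\<close>

lemma indep_outside:
  assumes Q: "Q \<in> sets m"
  shows "indep_set (sets (outside Q)) (sigma_sets (space M) (count_events {Q}))"
proof -
  let ?P = "{{\<omega>\<in>space M. \<forall>i<n. emeasure (N \<omega>) (A i) \<in> B i} | (n::nat) A B.
     (\<forall>i<n. A i \<in> sets m \<and> A i \<inter> Q = {} \<and> B i \<in> sets borel)}"
  have P_ev: "?P \<subseteq> events"
  proof
    fix a assume "a \<in> ?P"
    then obtain n :: nat and A B where a: "a = {\<omega>\<in>space M. \<forall>i<n. emeasure (N \<omega>) (A i) \<in> B i}"
      "\<forall>i<n. A i \<in> sets m \<and> A i \<inter> Q = {} \<and> B i \<in> sets borel"
      by (elim CollectE exE conjE) rule
    have "Measurable.pred M (\<lambda>\<omega>. \<forall>i\<in>{..<n}. emeasure (N \<omega>) (A i) \<in> B i)"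
      using a(2) by (intro pred_intros_finite) (auto intro!: measurable_compose[OF measurable_N])
    moreover have "a = {\<omega>\<in>space M. \<forall>i\<in>{..<n}. emeasure (N \<omega>) (A i) \<in> B i}"
      unfolding a(1) by auto
    ultimately show "a \<in> events" by (simp only: pred_def)
  qed
  have "indep_set ?P (count_events {Q})"
  proof (rule indep_setI[OF P_ev count_events_subset])
    fix a b assume "a \<in> ?P" and "b \<in> count_events {Q}"
    from \<open>a \<in> ?P\<close> obtain n :: nat and A B where a: "a = {\<omega>\<in>space M. \<forall>i<n. emeasure (N \<omega>) (A i) \<in> B i}"
      "\<forall>i<n. A i \<in> sets m \<and> A i \<inter> Q = {} \<and> B i \<in> sets borel"
      by (elim CollectE exE conjE) rule
    from \<open>b \<in> count_events {Q}\<close> obtain C where b: "b = {\<omega>\<in>space M. emeasure (N \<omega>) Q \<in> C}" "C \<in> sets borel"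
      by (auto simp: count_events_def vimage_def Int_def conj_commute)
    show "prob (a \<inter> b) = prob a * prob b"
      unfolding a(1) b(1) by (rule prob_joint_counts) (use a b Q in auto)
  qed
  moreover have "Int_stable ?P"
  proof (rule Int_stableI)
    fix a b assume "a \<in> ?P" and "b \<in> ?P"
    from \<open>a \<in> ?P\<close> obtain n :: nat and A B
      where a: "a = {\<omega>\<in>space M. \<forall>i<n. emeasure (N \<omega>) (A i) \<in> B i}"
      "\<forall>i<n. A i \<in> sets m \<and> A i \<inter> Q = {} \<and> B i \<in> sets borel"
      by (elim CollectE exE conjE) rule
    from \<open>b \<in> ?P\<close> obtain n' :: nat and A' B'
      where b: "b = {\<omega>\<in>space M. \<forall>i<n'. emeasure (N \<omega>) (A' i) \<in> B' i}"
      "\<forall>i<n'. A' i \<in> sets m \<and> A' i \<inter> Q = {} \<and> B' i \<in> sets borel"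
      by (elim CollectE exE conjE) rule
    \<comment> \<open>Two finite lists of conditions are concatenated into one.\<close>
    let ?A = "\<lambda>i. if i < n then A i else A' (i - n)"
    let ?B = "\<lambda>i. if i < n then B i else B' (i - n)"
    have "a \<inter> b = {\<omega>\<in>space M. \<forall>i<n + n'. emeasure (N \<omega>) (?A i) \<in> ?B i}"
    proof (intro set_eqI iffI)
      fix \<omega> assume *: "\<omega> \<in> {\<omega>\<in>space M. \<forall>i<n + n'. emeasure (N \<omega>) (?A i) \<in> ?B i}"
      have "emeasure (N \<omega>) (A i) \<in> B i" if "i < n" for i
        using * that by (auto dest!: spec[of _ i])
      moreover have "emeasure (N \<omega>) (A' i) \<in> B' i" if "i < n'" for i
        using * that by (auto dest!: spec[of _ "n + i"])
      ultimately show "\<omega> \<in> a \<inter> b" using * by (auto simp: a b)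
    qed (auto simp: a b)
    moreover have "\<forall>i<n + n'. ?A i \<in> sets m \<and> ?A i \<inter> Q = {} \<and> ?B i \<in> sets borel"
      using a b by auto
    ultimately show "a \<inter> b \<in> ?P"
      by (intro CollectI exI[of _ "n + n'"] exI[of _ ?A] exI[of _ ?B] conjI)
  qed
  moreover have "Int_stable (count_events {Q})"
  proof (rule Int_stableI)
    fix a b assume "a \<in> count_events {Q}" "b \<in> count_events {Q}"
    then obtain C C' where "C \<in> sets borel" "C' \<in> sets borel"
      "a = (\<lambda>\<omega>. emeasure (N \<omega>) Q) -` C \<inter> space M" "b = (\<lambda>\<omega>. emeasure (N \<omega>) Q) -` C' \<inter> space M"
      by (auto simp: count_events_def)
    then have "a \<inter> b = (\<lambda>\<omega>. emeasure (N \<omega>) Q) -` (C \<inter> C') \<inter> space M" "C \<inter> C' \<in> sets borel"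
      by auto
    then show "a \<inter> b \<in> count_events {Q}" using Q unfolding count_events_def by blast
  qed
  ultimately have ind: "indep_set (sigma_sets (space M) ?P) (sigma_sets (space M) (count_events {Q}))"
    by (rule indep_set_sigma_sets)
  \<comment> \<open>A generator of \<open>outside Q\<close> is a list with a single
    condition.\<close>
  have "count_events {A. A \<inter> Q = {}} \<subseteq> ?P"
  proof
    fix a assume "a \<in> count_events {A. A \<inter> Q = {}}"
    then obtain A B where *: "A \<in> sets m" "A \<inter> Q = {}" "B \<in> sets borel"
      "a = (\<lambda>\<omega>. emeasure (N \<omega>) A) -` B \<inter> space M"
      by (auto simp: count_events_def)
    then show "a \<in> ?P"
      by (intro CollectI exI[of _ "1::nat"] exI[of _ "\<lambda>_. A"] exI[of _ "\<lambda>_. B"]) auto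
  qed
  then have "sets (outside Q) \<subseteq> sigma_sets (space M) ?P"
    unfolding sets_outside by (rule sigma_sets_mono')
  with ind show ?thesis
    unfolding indep_sets2_eq by (meson subset_iff subset_trans)
qed

lemma indep_var_outside:
  fixes Z :: "'w \<Rightarrow> real" and f :: "ennreal \<Rightarrow> real"
  assumes Q: "Q \<in> sets m" and Z: "Z \<in> borel_measurable (outside Q)" and f: "f \<in> borel_measurable borel"
  shows "indep_var borel Z borel (\<lambda>\<omega>. f (emeasure (N \<omega>) Q))"
proof -
  have "random_variable borel Z"
    using Z subalgebra_outside by (auto simp: measurable_def)
  moreover have "random_variable borel (\<lambda>\<omega>. f (emeasure (N \<omega>) Q))"
    using Q f by measurable
  moreover have "sigma_sets (space M) {Z -` A \<inter> space M |A. A \<in> sets borel} \<subseteq> sets (outside Q)"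
    using sets.sigma_sets_subset[of "{Z -` A \<inter> space M |A. A \<in> sets borel}" "outside Q"]
      measurable_sets[OF Z] by auto
  moreover have "sigma_sets (space M) {(\<lambda>\<omega>. f (emeasure (N \<omega>) Q)) -` A \<inter> space M |A. A \<in> sets borel}
     \<subseteq> sigma_sets (space M) (count_events {Q})"
  proof (rule sigma_sets_mono', safe)
    fix A :: "real set" assume "A \<in> sets borel"
    then have "f -` A \<in> sets borel" using measurable_sets[OF f] by simp
    moreover have "(\<lambda>\<omega>. f (emeasure (N \<omega>) Q)) -` A \<inter> space M = (\<lambda>\<omega>. emeasure (N \<omega>) Q) -` (f -` A) \<inter> space M"
      by auto
    ultimately show "(\<lambda>\<omega>. f (emeasure (N \<omega>) Q)) -` A \<inter> space M \<in> count_events {Q}"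
      using Q by (auto simp: count_events_def)
  qed
  ultimately show ?thesis
    unfolding indep_var_eq using indep_outside[OF Q] unfolding indep_sets2_eq by blast
qed

lemma outside_antimono:
  "Q' \<subseteq> Q \<Longrightarrow> Z \<in> borel_measurable (outside Q) \<Longrightarrow> Z \<in> borel_measurable (outside Q')"
proof -
  assume "Q' \<subseteq> Q" "Z \<in> borel_measurable (outside Q)"
  moreover from \<open>Q' \<subseteq> Q\<close> have "count_events {A. A \<inter> Q = {}} \<subseteq> count_events {A. A \<inter> Q' = {}}"
    unfolding count_events_def by blast
  then have "sets (outside Q) \<subseteq> sets (outside Q')"
    unfolding sets_outside by (rule sigma_sets_mono')
  ultimately show ?thesis by (auto simp: measurable_def)
qed

end

section \<open>Moments of the compensated measure\<close>

lemma sums_exp: "(\<lambda>k. x ^ k / fact k) sums exp (x::real)"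
  using exp_converges[of x] by (simp add: divide_inverse_commute)

lemma exp_term_Suc: "x * (x ^ k / fact k) = real (Suc k) * (x ^ Suc k / fact (Suc k))"
  by (simp add: field_simps del: of_nat_Suc)

lemma sums_exp_times_index: "(\<lambda>k. real k * (x ^ k / fact k)) sums (x * exp x)"
proof -
  have "(\<lambda>k. x * (x ^ k / fact k)) sums (x * exp x)"
    by (intro sums_mult sums_exp)
  note this[unfolded exp_term_Suc]
  then show ?thesis
    using sums_Suc_iff[of "\<lambda>k. real k * (x ^ k / fact k)" "x * exp x"] by simp
qed

text \<open>With \<open>a k = x ^ k / fact k\<close> one has
  \<open>x * a k = (k + 1) * a (k + 1)\<close>, so the series is \<open>x * (k + 1) * a k\<close>
  shifted by one index.\<close>

lemma sums_exp_times_index_squared: "(\<lambda>k. (real k)\<^sup>2 * (x ^ k / fact k)) sums ((x\<^sup>2 + x) * exp x)"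
proof -
  have "(\<lambda>k. x * (real k * (x ^ k / fact k)) + x * (x ^ k / fact k)) sums (x * (x * exp x) + x * exp x)"
    by (intro sums_add sums_mult sums_exp sums_exp_times_index)
  moreover have "x * (real k * (x ^ k / fact k)) + x * (x ^ k / fact k) =
      (real (Suc k))\<^sup>2 * (x ^ Suc k / fact (Suc k))" for k
    by (subst power2_eq_square, subst mult.assoc, subst exp_term_Suc[symmetric]) (simp add: algebra_simps add_divide_distrib)
  ultimately show ?thesis
    using sums_Suc_iff[of "\<lambda>k. (real k)\<^sup>2 * (x ^ k / fact k)" "(x\<^sup>2 + x) * exp x"]
    by (simp add: power2_eq_square algebra_simps)
qed

section \<open>Mean, variance and covariance of the compensated noise\<close>

context poisson_noise
begin

lemma sums_poisson_law:
  assumes A: "A \<in> sets m" "emeasure m A < \<infinity>"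
    and "(\<lambda>k. f k * (measure m A ^ k / fact k)) sums (y * exp (measure m A))"
  shows "(\<lambda>k. f k * prob {\<omega>\<in>space M. emeasure (N \<omega>) A = of_nat k}) sums y"
  using sums_mult[OF assms(3), of "exp (- measure m A)"] poisson_law[OF A]
  by (simp add: algebra_simps exp_minus)

text \<open>The Poisson weights sum to 1, so no probability is left for other values; in particular
  the count is almost surely finite.\<close>

lemma AE_N_nat:
  assumes A: "A \<in> sets m" "emeasure m A < \<infinity>"
  shows "AE \<omega> in M. \<exists>k::nat. emeasure (N \<omega>) A = of_nat k"
proof -
  let ?E = "\<lambda>k::nat. {\<omega>\<in>space M. emeasure (N \<omega>) A = of_nat k}"
  have E: "?E k \<in> events" for k using A(1) by measurable
  have "(\<lambda>k. prob (?E k)) sums prob (\<Union>k. ?E k)"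
    by (rule finite_measure_UNION) (use E in \<open>auto simp: disjoint_family_on_def\<close>)
  moreover have "(\<lambda>k. prob (?E k)) sums 1"
    using sums_poisson_law[OF A, of "\<lambda>_. 1" 1] sums_exp by simp
  ultimately have "prob (\<Union>k. ?E k) = 1" by (rule sums_unique2)
  moreover have "(\<Union>k. ?E k) \<in> events" using E by auto
  ultimately have "AE \<omega> in M. \<omega> \<in> (\<Union>k. ?E k)" by (simp add: prob_eq_1)
  then show ?thesis by eventually_elim auto
qed

text \<open>Almost surely exactly one of the events \<open>N(A) = k\<close> occurs, so the
  expectation is a series over the Poisson weights; nonnegativity of \<open>f\<close> justifies the
  exchange of sum and integral.\<close>

lemma has_bochner_integral_N:
  assumes A: "A \<in> sets m" "emeasure m A < \<infinity>" and f: "f \<in> borel_measurable borel" "\<And>x. 0 \<le> f x"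
    and s: "(\<lambda>k. f (real k) * (measure m A ^ k / fact k)) sums (y * exp (measure m A))"
  shows "has_bochner_integral M (\<lambda>\<omega>. f (measure (N \<omega>) A)) y"
proof (rule has_bochner_integral_nn_integral)
  let ?E = "\<lambda>k::nat. {\<omega>\<in>space M. emeasure (N \<omega>) A = of_nat k}"
  note A(1)[measurable] f(1)[measurable]
  have E[measurable]: "?E k \<in> events" for k by measurable
  show "(\<lambda>\<omega>. f (measure (N \<omega>) A)) \<in> borel_measurable M"
    unfolding measure_def by measurable
  note sums = sums_poisson_law[OF A s]
  show "0 \<le> y"
    by (rule sums_le[OF _ sums_zero sums]) (simp add: f)
  have "(\<integral>\<^sup>+\<omega>. ennreal (f (measure (N \<omega>) A)) \<partial>M) =
      (\<integral>\<^sup>+\<omega>. (\<Sum>k. ennreal (f (real k)) * indicator (?E k) \<omega>) \<partial>M)"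
  proof (rule nn_integral_cong_AE, use AE_N_nat[OF A] AE_space in eventually_elim)
    case (elim \<omega>)
    then obtain k :: nat where k: "emeasure (N \<omega>) A = of_nat k" by blast
    have "(\<Sum>k. ennreal (f (real k)) * indicator (?E k) \<omega>) =
        (\<Sum>j\<in>{k}. ennreal (f (real j)) * indicator (?E j) \<omega>)"
      by (rule suminf_finite) (auto simp: k)
    then show ?case using k elim by (simp add: measure_def)
  qed
  also have "\<dots> = (\<Sum>k. \<integral>\<^sup>+\<omega>. ennreal (f (real k)) * indicator (?E k) \<omega> \<partial>M)"
    by (rule nn_integral_suminf) measurable
  also have "\<dots> = (\<Sum>k. ennreal (f (real k) * prob (?E k)))"
    by (simp add: nn_integral_cmult_indicator emeasure_eq_measure ennreal_mult' f)
  also have "\<dots> = ennreal y"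
    by (rule suminf_ennreal_eq[OF _ sums]) (simp add: f)
  finally show "(\<integral>\<^sup>+\<omega>. ennreal (f (measure (N \<omega>) A)) \<partial>M) = ennreal y" .
qed (auto simp: f)

lemma compensated_alt: "compensated m N A = (\<lambda>\<omega>. enn2real (emeasure (N \<omega>) A) - measure m A)"
  by (simp add: compensated_def[abs_def] measure_def)

lemma compensated_measurable [measurable]:
  assumes "A \<in> sets m"
  shows "compensated m N A \<in> borel_measurable M"
proof -
  note measurable_N[OF assms, measurable]
  show ?thesis unfolding compensated_alt by measurable
qed

lemma compensated_measurable_outside:
  assumes "A \<in> sets m" "A \<inter> Q = {}"
  shows "compensated m N A \<in> borel_measurable (outside Q)"
proof -
  note measurable_outside_N[OF assms, measurable]
  show ?thesis unfolding compensated_alt by measurable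
qed

text \<open>A Poisson variable has variance equal to its mean.\<close>

lemma
  assumes A: "A \<in> sets m" "emeasure m A < \<infinity>"
  shows compensated_moment1: "has_bochner_integral M (compensated m N A) 0"
    and compensated_moment2: "has_bochner_integral M (\<lambda>\<omega>. (compensated m N A \<omega>)\<^sup>2) (measure m A)"
proof -
  let ?l = "measure m A"
  \<comment> \<open>The absolute value makes the function nonnegative on the whole line; on counts
    it is the identity.\<close>
  have 1: "has_bochner_integral M (\<lambda>\<omega>. \<bar>measure (N \<omega>) A\<bar>) ?l"
    by (rule has_bochner_integral_N[OF A]) (use sums_exp_times_index in auto)
  then have 1: "has_bochner_integral M (\<lambda>\<omega>. measure (N \<omega>) A) ?l" by simp
  have 2: "has_bochner_integral M (\<lambda>\<omega>. (measure (N \<omega>) A)\<^sup>2) (?l\<^sup>2 + ?l)"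
    by (rule has_bochner_integral_N[OF A, where f="\<lambda>x. x\<^sup>2"]) (use sums_exp_times_index_squared in auto)
  have c: "has_bochner_integral M (\<lambda>\<omega>. c) c" for c :: real
    by (simp add: has_bochner_integral_iff prob_space)
  show "has_bochner_integral M (compensated m N A) 0"
    using has_bochner_integral_diff[OF 1 c[of ?l]] by (simp add: compensated_def[abs_def])
  have "has_bochner_integral M (\<lambda>\<omega>. (measure (N \<omega>) A)\<^sup>2 - 2 * ?l * measure (N \<omega>) A + ?l\<^sup>2)
      (?l\<^sup>2 + ?l - 2 * ?l * ?l + ?l\<^sup>2)"
    by (intro has_bochner_integral_add has_bochner_integral_diff has_bochner_integral_mult_right 1 2 c)
  then show "has_bochner_integral M (\<lambda>\<omega>. (compensated m N A \<omega>)\<^sup>2) (measure m A)"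
    by (simp add: compensated_def power2_eq_square algebra_simps)
qed

text \<open>Additivity holds only almost surely: real-valued \<open>measure\<close> is additive
  where both counts are finite.\<close>

lemma compensated_Un:
  assumes A: "A \<in> sets m" "emeasure m A < \<infinity>" and B: "B \<in> sets m" "emeasure m B < \<infinity>"
    and "A \<inter> B = {}"
  shows "AE \<omega> in M. compensated m N (A \<union> B) \<omega> = compensated m N A \<omega> + compensated m N B \<omega>"
  using AE_N_nat[OF A] AE_N_nat[OF B] AE_space
proof eventually_elim
  case (elim \<omega>)
  then have "measure (N \<omega>) (A \<union> B) = measure (N \<omega>) A + measure (N \<omega>) B"
    by (intro measure_Union) (use assms sets_N in auto)
  moreover have "measure m (A \<union> B) = measure m A + measure m B"
    by (intro measure_Union) (use assms in auto)
  ultimately show ?case by (simp add: compensated_def)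
qed

lemma compensated_indep:
  assumes Q: "Q \<in> sets m" "emeasure m Q < \<infinity>"
    and Z: "Z \<in> borel_measurable (outside Q)" "integrable M Z"
  shows "has_bochner_integral M (\<lambda>\<omega>. Z \<omega> * compensated m N Q \<omega>) 0"
    and "has_bochner_integral M (\<lambda>\<omega>. Z \<omega> * (compensated m N Q \<omega>)\<^sup>2) (expectation Z * measure m Q)"
proof -
  note m1 = compensated_moment1[OF Q] and m2 = compensated_moment2[OF Q]
  have i1: "indep_var borel Z borel (compensated m N Q)"
    using indep_var_outside[OF Q(1) Z(1), of "\<lambda>x. enn2real x - measure m Q"]
    by (simp add: compensated_alt)
  have i2: "indep_var borel Z borel (\<lambda>\<omega>. (compensated m N Q \<omega>)\<^sup>2)"
    using indep_var_outside[OF Q(1) Z(1), of "\<lambda>x. (enn2real x - measure m Q)\<^sup>2"]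
    by (simp add: compensated_alt)
  show "has_bochner_integral M (\<lambda>\<omega>. Z \<omega> * compensated m N Q \<omega>) 0"
    using indep_var_lebesgue_integral[OF i1] indep_var_integrable[OF i1] Z m1
    by (simp add: has_bochner_integral_iff)
  show "has_bochner_integral M (\<lambda>\<omega>. Z \<omega> * (compensated m N Q \<omega>)\<^sup>2) (expectation Z * measure m Q)"
    using indep_var_lebesgue_integral[OF i2] indep_var_integrable[OF i2] Z m2
    by (simp add: has_bochner_integral_iff)
qed

text \<open>Both sets are split along their intersection \<open>?K\<close> and the product is
  multiplied out. In each mixed term one factor lives on a set that the rest avoids, and this factor
  has mean 0; only \<open>Z\<close> times the square over \<open>?K\<close> survives. The weight may
  depend on the noise in \<open>A - B\<close>, since it only has to avoid \<open>B\<close>; its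
  boundedness keeps the products integrable.\<close>

lemma compensated_covariance:
  assumes A: "A \<in> sets m" "emeasure m A < \<infinity>" and B: "B \<in> sets m" "emeasure m B < \<infinity>"
    and Z: "Z \<in> borel_measurable (outside B)" "\<And>\<omega>. \<omega> \<in> space M \<Longrightarrow> \<bar>Z \<omega>\<bar> \<le> c"
  shows "has_bochner_integral M (\<lambda>\<omega>. Z \<omega> * (compensated m N A \<omega> * compensated m N B \<omega>))
    (expectation Z * measure m (A \<inter> B))"
proof -
  let ?c = "compensated m N"
  let ?K = "A \<inter> B" and ?A = "A - B" and ?B = "B - A"
  have K: "?K \<in> sets m" "emeasure m ?K < \<infinity>" and A': "?A \<in> sets m" "emeasure m ?A < \<infinity>"
    and B': "?B \<in> sets m" "emeasure m ?B < \<infinity>"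
    using A B emeasure_mono[of ?K A m] emeasure_mono[of ?A A m] emeasure_mono[of ?B B m]
    by (auto intro: le_less_trans)
  have ZM: "Z \<in> borel_measurable M"
    using Z(1) subalgebra_outside by (auto simp: measurable_def)
  have Zi: "integrable M Z"
    by (rule integrable_const_bound[of _ c]) (use ZM Z(2) in auto)
  have Zc: "integrable M (\<lambda>\<omega>. Z \<omega> * ?c D \<omega>)" if "D \<in> sets m" "emeasure m D < \<infinity>" for D
  proof (rule Bochner_Integration.integrable_bound)
    show "integrable M (\<lambda>\<omega>. c * ?c D \<omega>)"
      using compensated_moment1[OF that] by (auto simp: has_bochner_integral_iff)
    show "AE \<omega> in M. norm (Z \<omega> * ?c D \<omega>) \<le> norm (c * ?c D \<omega>)"
      using order_trans[OF Z(2) abs_ge_self] by (auto intro!: AE_I2 mult_right_mono simp: abs_mult)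
  qed (use ZM that in measurable)
  have ZK: "Z \<in> borel_measurable (outside ?K)" and ZB: "Z \<in> borel_measurable (outside ?B)"
    by (rule outside_antimono[OF _ Z(1)]; auto)+
  have "has_bochner_integral M (\<lambda>\<omega>. Z \<omega> * (?c ?K \<omega>)\<^sup>2 + (Z \<omega> * ?c ?B \<omega>) * ?c ?K \<omega> +
      (Z \<omega> * ?c ?A \<omega>) * ?c ?K \<omega> + (Z \<omega> * ?c ?A \<omega>) * ?c ?B \<omega>)
      (expectation Z * measure m ?K + 0 + 0 + 0)"
    by (intro has_bochner_integral_add compensated_indep(2) compensated_indep(1) K B' Zi
        ZK borel_measurable_times ZB compensated_measurable_outside A' Zc) auto
  then have *: "has_bochner_integral M (\<lambda>\<omega>. Z \<omega> * ((?c ?A \<omega> + ?c ?K \<omega>) * (?c ?B \<omega> + ?c ?K \<omega>)))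
      (expectation Z * measure m ?K)"
    by (simp add: algebra_simps power2_eq_square)
  have "?A \<union> ?K = A" "?B \<union> ?K = B" by auto
  then have "AE \<omega> in M. ?c A \<omega> = ?c ?A \<omega> + ?c ?K \<omega>" "AE \<omega> in M. ?c B \<omega> = ?c ?B \<omega> + ?c ?K \<omega>"
    using compensated_Un[OF A' K] compensated_Un[OF B' K] by auto
  then have "AE \<omega> in M. Z \<omega> * ((?c ?A \<omega> + ?c ?K \<omega>) * (?c ?B \<omega> + ?c ?K \<omega>)) = Z \<omega> * (?c A \<omega> * ?c B \<omega>)"
    by eventually_elim simp
  then show ?thesis
    using * has_bochner_integral_cong_AE[of _ M] ZM A B A' B' K
    by (subst (asm) has_bochner_integral_cong_AE) auto
qed

end

section \<open>The isometry of the stochastic integral\<close>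

lemma nn_integral_square_triangle:
  fixes f g h :: "'a \<Rightarrow> real"
  assumes [measurable]: "g \<in> borel_measurable M" "h \<in> borel_measurable M"
    and e: "e > 0" and fgh: "\<And>x. \<bar>f x\<bar> \<le> \<bar>g x\<bar> + \<bar>h x\<bar>"
  shows "(\<integral>\<^sup>+x. ennreal ((f x)\<^sup>2) \<partial>M) \<le>
    ennreal (1 + e) * (\<integral>\<^sup>+x. ennreal ((g x)\<^sup>2) \<partial>M) + ennreal (1 + 1 / e) * (\<integral>\<^sup>+x. ennreal ((h x)\<^sup>2) \<partial>M)"
proof -
  have sq: "(f x)\<^sup>2 \<le> (1 + e) * (g x)\<^sup>2 + (1 + 1 / e) * (h x)\<^sup>2" for x
  proof -
    have "(f x)\<^sup>2 \<le> (\<bar>g x\<bar> + \<bar>h x\<bar>)\<^sup>2"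
      using fgh[of x] by (metis abs_ge_zero power2_abs power_mono)
    \<comment> \<open>The defect in Young's inequality is a complete square.\<close>
    also have "\<dots> = (1 + e) * (g x)\<^sup>2 + (1 + 1 / e) * (h x)\<^sup>2 - (e * \<bar>g x\<bar> - \<bar>h x\<bar>)\<^sup>2 / e"
      using e by (simp add: field_simps power2_eq_square)
    also have "\<dots> \<le> (1 + e) * (g x)\<^sup>2 + (1 + 1 / e) * (h x)\<^sup>2"
      using e by simp
    finally show ?thesis .
  qed
  have "(\<integral>\<^sup>+x. ennreal ((f x)\<^sup>2) \<partial>M) \<le>
      (\<integral>\<^sup>+x. ennreal (1 + e) * ennreal ((g x)\<^sup>2) + ennreal (1 + 1 / e) * ennreal ((h x)\<^sup>2) \<partial>M)"
    using e by (intro nn_integral_mono)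
      (simp add: ennreal_mult[symmetric] ennreal_plus[symmetric] sq ennreal_leI del: ennreal_plus)
  also have "\<dots> = ennreal (1 + e) * (\<integral>\<^sup>+x. ennreal ((g x)\<^sup>2) \<partial>M) + ennreal (1 + 1 / e) * (\<integral>\<^sup>+x. ennreal ((h x)\<^sup>2) \<partial>M)"
    by (simp add: nn_integral_add nn_integral_cmult)
  finally show ?thesis .
qed

section \<open>Iterated integrals, filtration and predictability\<close>

locale levy_noise = poisson_noise M "intensity mu" N
  for M :: "'w measure" and mu :: "'d::euclidean_space measure" and N :: "'w \<Rightarrow> (real \<times> 'd \<times> 'd) measure" +
  assumes levy: "levy_measure mu"
begin

lemma sets_mu [measurable_cong]: "sets mu = sets borel"
  using levy by (simp add: levy_measure_def)

sublocale mu: sigma_finite_measure mu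
  using levy by (simp add: levy_measure_def)

sublocale lborel_mu: sigma_finite_measure "lborel \<Otimes>\<^sub>M mu :: ('d \<times> 'd) measure"
  by (intro sigma_finite_pair_measure lborel.sigma_finite_measure_axioms mu.sigma_finite_measure_axioms)

lemma nn_integral_space_jump:
  fixes F :: "'d \<times> 'd \<Rightarrow> ennreal"
  assumes F: "F \<in> borel_measurable (lborel \<Otimes>\<^sub>M mu)"
  shows "(\<integral>\<^sup>+xh. F xh \<partial>(lborel \<Otimes>\<^sub>M mu)) = (\<integral>\<^sup>+x. \<integral>\<^sup>+h. F (x, h) \<partial>mu \<partial>lborel)"
  by (rule mu.nn_integral_fst[OF F, symmetric])

lemma nn_integral_time_space_jump:
  fixes F :: "real \<times> 'd \<times> 'd \<Rightarrow> ennreal"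
  assumes F: "F \<in> borel_measurable (restrict_space lborel D \<Otimes>\<^sub>M lborel \<Otimes>\<^sub>M mu)" and D: "D \<in> sets borel"
  shows "(\<integral>\<^sup>+z. F z \<partial>(restrict_space lborel D \<Otimes>\<^sub>M lborel \<Otimes>\<^sub>M mu)) =
    (\<integral>\<^sup>+s\<in>D. (\<integral>\<^sup>+x. \<integral>\<^sup>+h. F (s, x, h) \<partial>mu \<partial>lborel) \<partial>lborel)"
proof -
  have "(\<integral>\<^sup>+z. F z \<partial>(restrict_space lborel D \<Otimes>\<^sub>M lborel \<Otimes>\<^sub>M mu)) =
      (\<integral>\<^sup>+s. (\<integral>\<^sup>+xh. F (s, xh) \<partial>(lborel \<Otimes>\<^sub>M mu)) \<partial>restrict_space lborel D)"
    by (rule lborel_mu.nn_integral_fst[OF F, symmetric])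
  also have "\<dots> = (\<integral>\<^sup>+s. (\<integral>\<^sup>+x. \<integral>\<^sup>+h. F (s, x, h) \<partial>mu \<partial>lborel) \<partial>restrict_space lborel D)"
    by (intro nn_integral_cong nn_integral_space_jump measurable_compose[OF measurable_Pair1' F])
  also have "\<dots> = (\<integral>\<^sup>+s\<in>D. (\<integral>\<^sup>+x. \<integral>\<^sup>+h. F (s, x, h) \<partial>mu \<partial>lborel) \<partial>lborel)"
    using D by (intro nn_integral_restrict_space) auto
  finally show ?thesis .
qed

text \<open>The sample point comes last because \<open>integrand_sq_norm\<close> integrates over it
  innermost. Time starts after 0, as in the predictable sigma-algebra.\<close>

definition jump_space :: "real \<Rightarrow> ((real \<times> 'd \<times> 'd) \<times> 'w) measure" where
  "jump_space T = (restrict_space lborel {0<..T} \<Otimes>\<^sub>M lborel \<Otimes>\<^sub>M mu) \<Otimes>\<^sub>M M"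

lemma integrand_sq_norm_eq:
  assumes X: "(\<lambda>((s, x, h), \<omega>). X s x h \<omega>) \<in> borel_measurable (jump_space T)"
  shows "integrand_sq_norm M mu T X =
    (\<integral>\<^sup>+z. ennreal (((\<lambda>((s, x, h), \<omega>). X s x h \<omega>) z)\<^sup>2) \<partial>jump_space T)"
proof -
  let ?R = "restrict_space lborel {0<..T} \<Otimes>\<^sub>M lborel \<Otimes>\<^sub>M mu"
  let ?f = "\<lambda>z. ennreal (((\<lambda>((s, x, h), \<omega>). X s x h \<omega>) z)\<^sup>2)"
  have f: "?f \<in> borel_measurable (?R \<Otimes>\<^sub>M M)"
    by (rule measurable_compose[OF X[unfolded jump_space_def]]) measurable
  have F: "(\<lambda>z. \<integral>\<^sup>+\<omega>. ?f (z, \<omega>) \<partial>M) \<in> borel_measurable ?R"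
    using f by (rule borel_measurable_nn_integral_fst)
  show ?thesis
    unfolding jump_space_def integrand_sq_norm_def nn_integral_fst[OF f, symmetric]
    by (subst nn_integral_time_space_jump[OF F]) auto
qed

lemma integrand_sq_norm_triangle:
  assumes X: "(\<lambda>((s, x, h), \<omega>). X s x h \<omega>) \<in> borel_measurable (jump_space T)"
    and S: "(\<lambda>((s, x, h), \<omega>). S s x h \<omega>) \<in> borel_measurable (jump_space T)"
    and e: "e > 0"
  shows "integrand_sq_norm M mu T X \<le> ennreal (1 + e) * integrand_sq_norm M mu T S +
    ennreal (1 + 1 / e) * integrand_sq_norm M mu T (\<lambda>s x h \<omega>. S s x h \<omega> - X s x h \<omega>)"
proof -
  let ?X = "\<lambda>((s, x, h), \<omega>). X s x h \<omega>" and ?S = "\<lambda>((s, x, h), \<omega>). S s x h \<omega>"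
  have [simp]: "(\<lambda>((s, x, h), \<omega>). S s x h \<omega> - X s x h \<omega>) = (\<lambda>z. ?S z - ?X z)" by auto
  have D: "(\<lambda>((s, x, h), \<omega>). S s x h \<omega> - X s x h \<omega>) \<in> borel_measurable (jump_space T)"
    unfolding \<open>_ = (\<lambda>z. ?S z - ?X z)\<close> by (intro borel_measurable_diff S X)
  show ?thesis
    unfolding integrand_sq_norm_eq[OF X] integrand_sq_norm_eq[OF S] integrand_sq_norm_eq[OF D]
    by (rule nn_integral_square_triangle[OF S D e]) (auto simp: abs_le_iff)
qed

lemma space_noise_filtration [simp]: "space (noise_filtration M mu N t) = space M"
  by (auto simp: noise_filtration_def intro!: space_measure_of)

lemma sets_noise_filtration:
  "sets (noise_filtration M mu N t) = sigma_sets (space M) (count_events {A. A \<subseteq> {0..t} \<times> UNIV})"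
proof -
  have "{(\<lambda>\<omega>. emeasure (N \<omega>) A) -` B \<inter> space M | A B.
      A \<in> sets (intensity mu) \<and> A \<subseteq> {0..t} \<times> UNIV \<and> B \<in> sets borel} = count_events {A. A \<subseteq> {0..t} \<times> UNIV}"
    by (auto simp: count_events_def)
  moreover have "count_events {A. A \<subseteq> {0..t} \<times> UNIV} \<subseteq> Pow (space M)"
    by (auto simp: count_events_def)
  ultimately show ?thesis by (simp add: noise_filtration_def)
qed

lemma noise_filtration_subalgebra: "sets (noise_filtration M mu N t) \<subseteq> events"
  unfolding sets_noise_filtration by (rule sets.sigma_sets_subset[OF count_events_subset])

lemma measurable_noise_filtrationD:
  "Y \<in> borel_measurable (noise_filtration M mu N t) \<Longrightarrow> Y \<in> borel_measurable M"
  using noise_filtration_subalgebra[of t] by (auto simp: measurable_def)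

text \<open>A set of times up to \<open>t\<close> is disjoint from a set of times after
  \<open>t\<close>.\<close>

lemma noise_filtration_outside:
  assumes "Y \<in> borel_measurable (noise_filtration M mu N t)" "Q \<subseteq> {t<..} \<times> UNIV"
  shows "Y \<in> borel_measurable (outside Q)"
proof -
  have "count_events {A. A \<subseteq> {0..t} \<times> UNIV} \<subseteq> count_events {A. A \<inter> Q = {}}"
    using assms(2) unfolding count_events_def by fastforce
  then have "sets (noise_filtration M mu N t) \<subseteq> sets (outside Q)"
    unfolding sets_outside sets_noise_filtration by (rule sigma_sets_mono')
  then show ?thesis using assms(1) by (auto simp: measurable_def)
qed

text \<open>A generator \<open>F \<times> {a<..b}\<close> pulls back to a time strip intersected
  with an event, so predictable integrands are jointly measurable on the product space.\<close>

lemma predictable_algebra_measurable: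
  "(\<lambda>((s, x, h), \<omega>). (\<omega>, s)) \<in> jump_space T \<rightarrow>\<^sub>M predictable_algebra M mu N"
  unfolding predictable_algebra_def
proof (rule measurable_sigma_sets[OF sets_measure_of])
  let ?C = "{F \<times> {a<..b} |F a b. 0 \<le> a \<and> a \<le> b \<and> F \<in> sets (noise_filtration M mu N a)}"
  show "?C \<subseteq> Pow (space M \<times> {0<..})" "?C \<subseteq> Pow (space M \<times> {0<..})"
    using noise_filtration_subalgebra sets.sets_into_space by fastforce+
  show "(\<lambda>((s, x, h), \<omega>). (\<omega>, s)) \<in> space (jump_space T) \<rightarrow> space M \<times> {0<..}"
    by (auto simp: jump_space_def space_pair_measure space_restrict_space)
  fix E assume "E \<in> ?C"
  then obtain F a b where E: "E = F \<times> {a<..b}" "F \<in> sets (noise_filtration M mu N a)" by auto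
  then have F: "F \<in> events" using noise_filtration_subalgebra by auto
  have "(\<lambda>((s, x, h), \<omega>). (\<omega>, s)) -` E \<inter> space (jump_space T) =
      (\<lambda>z. fst (fst z)) -` {a<..b} \<inter> space (jump_space T) \<inter> (snd -` F \<inter> space (jump_space T))"
    by (auto simp: E)
  also have "\<dots> \<in> sets (jump_space T)"
  proof (rule sets.Int)
    have "(\<lambda>z. fst (fst z)) \<in> borel_measurable (jump_space T)"
      unfolding jump_space_def
      by (rule measurable_compose[OF measurable_fst], rule measurable_compose[OF measurable_fst],
          rule measurable_restrict_space1) simp
    then show "(\<lambda>z. fst (fst z)) -` {a<..b} \<inter> space (jump_space T) \<in> sets (jump_space T)"
      by (rule measurable_sets) simp
    show "snd -` F \<inter> space (jump_space T) \<in> sets (jump_space T)"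
      unfolding jump_space_def by (rule measurable_sets[OF measurable_snd F])
  qed
  finally show "(\<lambda>((s, x, h), \<omega>). (\<omega>, s)) -` E \<inter> space (jump_space T) \<in> sets (jump_space T)" .
qed

lemma predictable_integrand_measurable:
  assumes "predictable_integrand M mu N X"
  shows "(\<lambda>((s, x, h), \<omega>). X s x h \<omega>) \<in> borel_measurable (jump_space T)"
proof -
  have "(\<lambda>z. ((\<lambda>((s, x, h), \<omega>). (\<omega>, s)) z, fst (snd (fst z)), snd (snd (fst z)))) \<in>
      jump_space T \<rightarrow>\<^sub>M (predictable_algebra M mu N \<Otimes>\<^sub>M borel \<Otimes>\<^sub>M borel)"
    by (intro measurable_Pair predictable_algebra_measurable) (simp_all add: jump_space_def)
  from measurable_compose[OF this assms[unfolded predictable_integrand_def]]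
  show ?thesis by (simp add: case_prod_beta')
qed

section \<open>Second moments of simple and general integrals\<close>

lemma intensity_rectangle:
  assumes "0 \<le> a" "a \<le> b" "B \<in> sets (lborel \<Otimes>\<^sub>M mu)" "emeasure (lborel \<Otimes>\<^sub>M mu) B < \<infinity>"
  shows "{a<..b} \<times> B \<in> sets (intensity mu)" "emeasure (intensity mu) ({a<..b} \<times> B) < \<infinity>"
proof -
  have ab: "{a<..b} \<in> sets (restrict_space lborel {0..})"
    using assms by (auto simp: sets_restrict_space_iff)
  then show "{a<..b} \<times> B \<in> sets (intensity mu)"
    unfolding intensity_def using assms by simp
  have "emeasure (restrict_space lborel {0..}) {a<..b} = ennreal (b - a)"
    using assms by (subst emeasure_restrict_space) auto
  then show "emeasure (intensity mu) ({a<..b} \<times> B) < \<infinity>"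
    unfolding intensity_def using assms ab
    by (simp add: lborel_mu.emeasure_pair_measure_Times ennreal_mult_less_top)
qed

text \<open>The constant \<open>c\<close> stands for the deterministic part of a mild solution; its
  cross term vanishes because \<open>J\<close> has mean 0. The second moment of \<open>J\<close> and
  the norm of \<open>S\<close> both equal the same double sum \<open>V\<close> over pairs of
  possibly overlapping rectangles.\<close>

lemma simple_integral_isometry:
  assumes "simple_integral M mu N T S J"
  shows "(\<integral>\<^sup>+\<omega>. ennreal ((c + J \<omega>)\<^sup>2) \<partial>M) = ennreal (c\<^sup>2) + integrand_sq_norm M mu T S"
    and "J \<in> borel_measurable M"
    and "(\<lambda>((s, x, h), \<omega>). S s x h \<omega>) \<in> borel_measurable (jump_space T)"
proof -
  obtain n :: nat and Y a b B where
    *: "\<forall>i<n. 0 \<le> a i \<and> a i \<le> b i \<and> b i \<le> T \<and>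
               Y i \<in> borel_measurable (noise_filtration M mu N (a i)) \<and>
               bounded (Y i ` space M) \<and>
               B i \<in> sets (lborel \<Otimes>\<^sub>M mu) \<and> emeasure (lborel \<Otimes>\<^sub>M mu) (B i) < \<infinity>"
    and S: "S = (\<lambda>s x h \<omega>. \<Sum>i<n. Y i \<omega> * indicator {a i<..b i} s * indicator (B i) (x, h))"
    and J: "J = (\<lambda>\<omega>. \<Sum>i<n. Y i \<omega> * compensated (intensity mu) N ({a i<..b i} \<times> B i) \<omega>)"
    using assms[unfolded simple_integral_def] by (elim exE conjE) rule
  define A where "A i = {a i<..b i} \<times> B i" for i
  let ?I = "intensity mu"
  let ?c = "\<lambda>i. compensated ?I N (A i)"
  define w where "w i j = expectation (\<lambda>\<omega>. Y i \<omega> * Y j \<omega>)" for i j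
  define V where "V = (\<Sum>i<n. \<Sum>j<n. w i j * measure ?I (A i \<inter> A j))"
  have A: "A i \<in> sets ?I" "emeasure ?I (A i) < \<infinity>" if "i < n" for i
    using intensity_rectangle * that by (auto simp: A_def)
  have YM: "Y i \<in> borel_measurable M" if "i < n" for i
    using * that measurable_noise_filtrationD by blast
  have "\<exists>K. \<forall>\<omega>\<in>space M. \<bar>Y i \<omega>\<bar> \<le> K" if "i < n" for i
    using * that by (auto simp: bounded_iff)
  then obtain K where K: "\<And>i \<omega>. i < n \<Longrightarrow> \<omega> \<in> space M \<Longrightarrow> \<bar>Y i \<omega>\<bar> \<le> K i" by metis
  \<comment> \<open>The intervals exclude their left end, so even \<open>Y j\<close> itself avoids
    its own rectangle \<open>A j\<close>.\<close>
  have Yout: "Y i \<in> borel_measurable (outside (A j))" if "i < n" "j < n" "a i \<le> a j" for i j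
    by (rule noise_filtration_outside) (use * that in \<open>auto simp: A_def\<close>)
  have Yi: "integrable M (Y i)" if "i < n" for i
    by (rule integrable_const_bound[of _ "K i"]) (use that K YM in auto)
  have YYb: "\<bar>Y i \<omega> * Y j \<omega>\<bar> \<le> K i * K j" if "i < n" "j < n" "\<omega> \<in> space M" for i j \<omega>
    unfolding abs_mult using K that by (intro mult_mono) (auto intro: order_trans[OF abs_ge_zero])
  have YYi: "integrable M (\<lambda>\<omega>. Y i \<omega> * Y j \<omega>)" if "i < n" "j < n" for i j
    by (rule integrable_const_bound[of _ "K i * K j"]) (use that YYb YM in auto)
  have cov: "has_bochner_integral M (\<lambda>\<omega>. (Y i \<omega> * ?c i \<omega>) * (Y j \<omega> * ?c j \<omega>)) (w i j * measure ?I (A i \<inter> A j))"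
    if "i < n" "j < n" for i j
  proof -
    \<comment> \<open>Both weights must avoid the second rectangle, so the one that starts later is
      put second; the other order follows by symmetry.\<close>
    have le: "has_bochner_integral M (\<lambda>\<omega>. Y i \<omega> * Y j \<omega> * (?c i \<omega> * ?c j \<omega>)) (w i j * measure ?I (A i \<inter> A j))"
      if "i < n" "j < n" "a i \<le> a j" for i j
      unfolding w_def
      by (rule compensated_covariance[where c = "K i * K j"]) (use that A Yout YYb in auto)
    show ?thesis
      using le[of i j] le[of j i] that
      by (cases "a i \<le> a j") (simp_all add: w_def mult_ac Int_commute)
  qed
  have J': "J = (\<lambda>\<omega>. \<Sum>i<n. Y i \<omega> * ?c i \<omega>)" by (simp add: J A_def)
  show JM: "J \<in> borel_measurable M"
    unfolding J' using A YM by (intro borel_measurable_sum borel_measurable_times compensated_measurable) auto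
  have J1: "has_bochner_integral M J 0"
  proof -
    have "has_bochner_integral M J (\<Sum>i<n. 0)"
      unfolding J' using A Yout Yi by (intro has_bochner_integral_sum compensated_indep(1)) auto
    then show ?thesis by simp
  qed
  have J2: "has_bochner_integral M (\<lambda>\<omega>. (J \<omega>)\<^sup>2) V"
    unfolding V_def J' power2_eq_square sum_product
    by (intro has_bochner_integral_sum cov) auto
  have "has_bochner_integral M (\<lambda>\<omega>. c\<^sup>2 + 2 * c * J \<omega> + (J \<omega>)\<^sup>2) (c\<^sup>2 + 2 * c * 0 + V)"
    by (intro has_bochner_integral_add has_bochner_integral_mult_right J1 J2)
      (simp add: has_bochner_integral_iff prob_space)
  then have "has_bochner_integral M (\<lambda>\<omega>. (c + J \<omega>)\<^sup>2) (c\<^sup>2 + V)"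
    by (simp add: power2_eq_square algebra_simps)
  then have "(\<integral>\<^sup>+\<omega>. ennreal ((c + J \<omega>)\<^sup>2) \<partial>M) = ennreal (c\<^sup>2 + V)"
    by (subst nn_integral_eq_integral) (auto simp: has_bochner_integral_iff)
  moreover have "V \<ge> 0"
    using J2 by (auto simp: has_bochner_integral_iff intro!: Bochner_Integration.integral_nonneg)
  moreover have "integrand_sq_norm M mu T S = ennreal V"
  proof -
    \<comment> \<open>\<open>q\<close> is the expectation of \<open>S\<close> squared as a function
      of time, place and jump; integrating it against the intensity gives \<open>V\<close>.\<close>
    define q :: "real \<times> 'd \<times> 'd \<Rightarrow> real" where "q z = (\<Sum>i<n. \<Sum>j<n. w i j * indicator (A i \<inter> A j) z)" for z
    have Sz: "S s x h \<omega> = (\<Sum>i<n. Y i \<omega> * indicator (A i) (s, x, h))" for s x h \<omega>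
      by (simp add: S A_def indicator_times mult.assoc)
    have SM: "has_bochner_integral M (\<lambda>\<omega>. (S s x h \<omega>)\<^sup>2) (q (s, x, h))" for s x h
    proof -
      have "has_bochner_integral M (\<lambda>\<omega>. \<Sum>i<n. \<Sum>j<n. Y i \<omega> * Y j \<omega> * indicator (A i \<inter> A j) (s, x, h)) (q (s, x, h))"
        unfolding q_def w_def using YYi
        by (intro has_bochner_integral_sum has_bochner_integral_mult_left) (auto simp: has_bochner_integral_iff)
      moreover have "(S s x h \<omega>)\<^sup>2 = (\<Sum>i<n. \<Sum>j<n. Y i \<omega> * Y j \<omega> * indicator (A i \<inter> A j) (s, x, h))" for \<omega>
        unfolding Sz power2_eq_square sum_product by (intro sum.cong refl) (auto simp: indicator_def)
      ultimately show ?thesis by simp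
    qed
    \<comment> \<open>The signs of the coefficients are unknown; nonnegativity comes from
      \<open>q\<close> being a second moment.\<close>
    have q0: "q (s, x, h) \<ge> 0" for s x h
      using SM[of s x h, THEN has_bochner_integral_integral_eq]
        Bochner_Integration.integral_nonneg[of M "\<lambda>\<omega>. (S s x h \<omega>)\<^sup>2"] by simp
    have q: "(\<integral>\<^sup>+\<omega>. ennreal ((S s x h \<omega>)\<^sup>2) \<partial>M) = ennreal (q (s, x, h))" for s x h
      using SM[of s x h] by (subst nn_integral_eq_integral) (auto simp: has_bochner_integral_iff)
    have AA: "A i \<inter> A j \<in> sets ?I" "emeasure ?I (A i \<inter> A j) < \<infinity>" if "i < n" "j < n" for i j
      using A that emeasure_mono[of "A i \<inter> A j" "A i" ?I] by (auto intro: le_less_trans)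
    have qI: "has_bochner_integral ?I q V"
      unfolding V_def q_def[abs_def]
      by (intro has_bochner_integral_sum has_bochner_integral_mult_right has_bochner_integral_real_indicator AA) auto
    then have "ennreal V = (\<integral>\<^sup>+z. ennreal (q z) \<partial>?I)"
      using q0 by (subst nn_integral_eq_integral) (auto simp: has_bochner_integral_iff)
    also have "\<dots> = (\<integral>\<^sup>+s\<in>{0..}. (\<integral>\<^sup>+x. \<integral>\<^sup>+h. ennreal (q (s, x, h)) \<partial>mu \<partial>lborel) \<partial>lborel)"
      using qI unfolding intensity_def
      by (intro nn_integral_time_space_jump) (auto simp: has_bochner_integral_iff)
    \<comment> \<open>The intensity covers all times from 0 on, the norm only
      \<open>{0<..T}\<close>; \<open>q\<close> vanishes outside the rectangles, which lie in this
      range.\<close>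
    also have "\<dots> = integrand_sq_norm M mu T S"
      unfolding integrand_sq_norm_def q
    proof (intro nn_integral_cong)
      fix s :: real
      have "q (s, x, h) = 0" if "s \<notin> {0<..T}" for x h
      proof -
        have "(s, x, h) \<notin> A i" if "i < n" for i
          using * that \<open>s \<notin> {0<..T}\<close> by (force simp: A_def)
        then show ?thesis by (simp add: q_def)
      qed
      then show "(\<integral>\<^sup>+x. \<integral>\<^sup>+h. ennreal (q (s, x, h)) \<partial>mu \<partial>lborel) * indicator {0..} s =
          (\<integral>\<^sup>+x. \<integral>\<^sup>+h. ennreal (q (s, x, h)) \<partial>mu \<partial>lborel) * indicator {0<..T} s"
        by (auto split: split_indicator)
    qed
    finally show ?thesis ..
  qed
  ultimately show "(\<integral>\<^sup>+\<omega>. ennreal ((c + J \<omega>)\<^sup>2) \<partial>M) = ennreal (c\<^sup>2) + integrand_sq_norm M mu T S"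
    by simp
  show "(\<lambda>((s, x, h), \<omega>). S s x h \<omega>) \<in> borel_measurable (jump_space T)"
  proof -
    have tx: "(\<lambda>z. fst (fst z)) \<in> borel_measurable (jump_space T)"
      "(\<lambda>z. snd (fst z)) \<in> jump_space T \<rightarrow>\<^sub>M (lborel \<Otimes>\<^sub>M mu)" "snd \<in> jump_space T \<rightarrow>\<^sub>M M"
      unfolding jump_space_def
      by (auto intro!: measurable_compose[OF measurable_fst] measurable_restrict_space1)
    have "(\<lambda>z. \<Sum>i<n. Y i (snd z) * indicator {a i<..b i} (fst (fst z)) * indicator (B i) (snd (fst z)))
        \<in> borel_measurable (jump_space T)"
      using * YM
      by (intro borel_measurable_sum borel_measurable_times measurable_compose[OF tx(3)]
          measurable_compose[OF tx(1)] measurable_compose[OF tx(2)] borel_measurable_indicator) auto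
    then show ?thesis by (simp add: S case_prod_beta')
  qed
qed

text \<open>The \<open>L\<^sup>2\<close> distances enter through \<open>(a + b)\<^sup>2 \<le> (1 + e) a\<^sup>2 + (1 + 1/e) b\<^sup>2\<close>, which needs no
  finiteness of the second moment of \<open>I\<close>.\<close>

lemma compensated_integral_second_moment:
  assumes "has_compensated_integral M mu N T X I"
  shows "ennreal (c\<^sup>2) + integrand_sq_norm M mu T X \<le> (\<integral>\<^sup>+\<omega>. ennreal ((c + I \<omega>)\<^sup>2) \<partial>M)"
proof -
  from assms obtain S J where X: "predictable_integrand M mu N X" and I: "I \<in> borel_measurable M"
    and SJ: "\<And>k::nat. simple_integral M mu N T (S k) (J k)"
    and S: "(\<lambda>k. integrand_sq_norm M mu T (\<lambda>s x h \<omega>. S k s x h \<omega> - X s x h \<omega>)) \<longlonglongrightarrow> 0" (is "?dS \<longlonglongrightarrow> 0")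
    and J: "(\<lambda>k. \<integral>\<^sup>+\<omega>. ennreal ((J k \<omega> - I \<omega>)\<^sup>2) \<partial>M) \<longlonglongrightarrow> 0" (is "?dJ \<longlonglongrightarrow> 0")
    unfolding has_compensated_integral_def by blast
  let ?L = "ennreal (c\<^sup>2) + integrand_sq_norm M mu T X" and ?R = "\<integral>\<^sup>+\<omega>. ennreal ((c + I \<omega>)\<^sup>2) \<partial>M"
  \<comment> \<open>One factor \<open>1 + e\<close> pays for replacing \<open>X\<close> by
    \<open>S k\<close>, the other for replacing \<open>J k\<close> by \<open>I\<close>. First
    \<open>k\<close> tends to infinity with \<open>e\<close> fixed, and only afterwards
    \<open>e\<close> to 0.\<close>
  have e_le: "?L \<le> ennreal ((1 + e)\<^sup>2) * ?R" if e: "e > 0" for e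
  proof (rule LIMSEQ_le_const)
    let ?q = "1 + 1 / e"
    let ?b = "\<lambda>k. ennreal (1 + e) * (ennreal (1 + e) * ?R + ennreal ?q * ?dJ k) + ennreal ?q * ?dS k"
    have "?b \<longlonglongrightarrow> ennreal (1 + e) * (ennreal (1 + e) * ?R + ennreal ?q * 0) + ennreal ?q * 0"
      by (intro tendsto_intros ennreal_tendsto_cmult S J) auto
    then show "?b \<longlonglongrightarrow> ennreal ((1 + e)\<^sup>2) * ?R"
      using e by (simp add: power2_eq_square ennreal_mult mult.assoc)
    have "?L \<le> ?b k" for k
    proof -
      note iso = simple_integral_isometry[OF SJ[of k]]
      have "integrand_sq_norm M mu T X \<le> ennreal (1 + e) * integrand_sq_norm M mu T (S k) + ennreal ?q * ?dS k"
        by (rule integrand_sq_norm_triangle[OF predictable_integrand_measurable[OF X] iso(3) e])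
      moreover have "ennreal (c\<^sup>2) \<le> ennreal (1 + e) * ennreal (c\<^sup>2)"
        using e by (subst ennreal_mult[symmetric]) (auto intro!: ennreal_leI simp: algebra_simps)
      ultimately have "?L \<le> ennreal (1 + e) * (ennreal (c\<^sup>2) + integrand_sq_norm M mu T (S k)) + ennreal ?q * ?dS k"
        by (simp add: distrib_left add.assoc add_mono)
      also have "\<dots> = ennreal (1 + e) * (\<integral>\<^sup>+\<omega>. ennreal ((c + J k \<omega>)\<^sup>2) \<partial>M) + ennreal ?q * ?dS k"
        by (simp add: iso(1))
      also have "\<dots> \<le> ?b k"
      proof (intro add_mono mult_left_mono order_refl)
        show "(\<integral>\<^sup>+\<omega>. ennreal ((c + J k \<omega>)\<^sup>2) \<partial>M) \<le> ennreal (1 + e) * ?R + ennreal ?q * ?dJ k"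
          by (rule nn_integral_square_triangle) (use I iso(2) e in auto)
      qed auto
      finally show ?thesis .
    qed
    then show "\<exists>N. \<forall>k\<ge>N. ?L \<le> ?b k" by blast
  qed
  show ?thesis
  proof (cases "?R = \<infinity>")
    case False
    then obtain r where r: "?R = ennreal r" "r \<ge> 0" by (cases ?R) auto
    show ?thesis
    proof (rule tendsto_le[OF trivial_limit_at_right_real])
      have "((\<lambda>e. (1 + e)\<^sup>2 * r) \<longlongrightarrow> (1 + 0)\<^sup>2 * r) (at_right (0::real))"
        by (intro tendsto_intros)
      then have "((\<lambda>e. ennreal ((1 + e)\<^sup>2 * r)) \<longlongrightarrow> ennreal ((1 + 0)\<^sup>2 * r)) (at_right (0::real))"
        by (rule tendsto_ennrealI)
      then show "((\<lambda>e. ennreal ((1 + e)\<^sup>2 * r)) \<longlongrightarrow> ?R) (at_right (0::real))" by (simp add: r)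
      show "((\<lambda>e. ?L) \<longlongrightarrow> ?L) (at_right (0::real))" by (rule tendsto_const)
      show "\<forall>\<^sub>F e in at_right (0::real). ?L \<le> ennreal ((1 + e)\<^sup>2 * r)"
        by (rule eventually_mono[OF eventually_at_right_less[of "0::real"]])
          (use e_le r in \<open>simp add: ennreal_mult\<close>)
    qed
  qed simp
qed

end

section \<open>The stable density\<close>

locale stable_kernel =
  fixes \<nu> \<alpha> \<beta> :: real and p :: "real \<Rightarrow> 'd::euclidean_space \<Rightarrow> real" and g :: "real \<Rightarrow> real"
  assumes \<alpha>: "0 < \<alpha>" and \<beta>: "0 < \<beta>"
    and p: "stable_density \<nu> \<alpha> p" and g: "subordinator_density \<beta> g"
begin

lemma p_nonneg: "0 < s \<Longrightarrow> 0 \<le> p s x"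
  and p_cont: "continuous_on ({0<..} \<times> UNIV) (\<lambda>(s, x). p s x)"
  and p_fourier: "0 < s \<Longrightarrow> (LINT x|lborel. cis (- (\<xi> \<bullet> x)) * complex_of_real (p s x)) =
              complex_of_real (exp (- s * \<nu> * norm \<xi> powr \<alpha>))"
  using p by (auto simp: stable_density_def)

lemma g_measurable [measurable]: "g \<in> borel_measurable borel"
  and g_nonneg: "0 \<le> g r" and g_nonpos: "r \<le> 0 \<Longrightarrow> g r = 0"
  and g_laplace: "0 \<le> q \<Longrightarrow> (LINT r|lborel. exp (- q * r) * g r) = exp (- (q powr \<beta>))"
  using g by (auto simp: subordinator_density_def)

lemma p_measurable [measurable]: "0 < s \<Longrightarrow> p s \<in> borel_measurable borel"
proof -
  assume s: "0 < s"
  have "continuous_on UNIV (\<lambda>x. (\<lambda>(s, x). p s x) (s, x))"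
    by (rule continuous_on_compose2[OF p_cont]) (use s in \<open>auto intro!: continuous_intros\<close>)
  then show ?thesis by (auto intro: borel_measurable_continuous_onI)
qed

text \<open>The indicator removes \<open>s \<le> 0\<close>, where \<open>p\<close> is arbitrary; on
  the open half-space \<open>p\<close> is continuous.\<close>

lemma p_measurable_joint:
  "(\<lambda>(s, x). indicator {0<..} s * p s x) \<in> borel_measurable (borel \<Otimes>\<^sub>M borel)"
proof -
  have "(\<lambda>z. indicator ({0<..} \<times> UNIV) z *\<^sub>R (case z of (s, x) \<Rightarrow> p s x)) \<in> borel_measurable borel"
    by (rule borel_measurable_continuous_on_indicator[OF _ p_cont]) (intro borel_open open_Times; simp)
  moreover have "(\<lambda>z. indicator ({0<..} \<times> UNIV) z *\<^sub>R (case z of (s, x) \<Rightarrow> p s x)) =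
      (\<lambda>(s, x). indicator {0<..} s * p s x)"
    by (auto simp: fun_eq_iff indicator_def)
  ultimately show ?thesis by (simp add: borel_prod)
qed

lemma p_mass:
  assumes "0 < s" shows "(\<integral>\<^sup>+x. ennreal (p s x) \<partial>lborel) = 1"
proof -
  have *: "(LINT x|lborel. complex_of_real (p s x)) = 1"
    using p_fourier[OF assms, of 0] \<alpha> by simp
  then have "integrable lborel (\<lambda>x. complex_of_real (p s x))"
    by (metis not_integrable_integral_eq zero_neq_one)
  then have i: "integrable lborel (p s)"
    using integrable_Re by fastforce
  have "(LINT x|lborel. p s x) = 1"
    using * by (metis integral_complex_of_real of_real_eq_1_iff)
  with i show ?thesis
    by (subst nn_integral_eq_integral) (auto simp: p_nonneg assms)
qed

section \<open>Coordinate marginals and self-similarity\<close>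

definition marginal :: "real \<Rightarrow> 'd \<Rightarrow> real measure" where
  "marginal s b = distr (density lborel (\<lambda>x. ennreal (p s x))) borel (\<lambda>x. x \<bullet> b)"

lemma marginal_distribution:
  assumes s: "0 < s" shows "real_distribution (marginal s b)"
proof -
  have "prob_space (density lborel (\<lambda>x. ennreal (p s x)))"
    by (rule prob_spaceI) (use s p_mass in \<open>simp add: emeasure_density\<close>)
  then interpret prob_space "density lborel (\<lambda>x. ennreal (p s x))" .
  show ?thesis
    unfolding marginal_def by (rule real_distribution_distr) simp
qed

lemma char_marginal:
  assumes s: "0 < s" and b: "b \<in> Basis"
  shows "char (marginal s b) t = complex_of_real (exp (- s * \<nu> * \<bar>t\<bar> powr \<alpha>))"
proof -
  have "char (marginal s b) t = (CLINT x|density lborel (\<lambda>x. ennreal (p s x)). iexp (t * (x \<bullet> b)))"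
    unfolding char_def marginal_def by (subst integral_distr) simp_all
  also have "\<dots> = (LINT x|lborel. p s x *\<^sub>R iexp (t * (x \<bullet> b)))"
    by (rule integral_density) (use s p_nonneg in auto)
  also have "\<dots> = (LINT x|lborel. cis (- ((- t *\<^sub>R b) \<bullet> x)) * complex_of_real (p s x))"
    by (intro Bochner_Integration.integral_cong refl)
      (simp add: scaleR_conv_of_real cis_conv_exp inner_commute mult.commute)
  also have "\<dots> = complex_of_real (exp (- s * \<nu> * \<bar>t\<bar> powr \<alpha>))"
    using p_fourier[OF s, of "- t *\<^sub>R b"] b by simp
  finally show ?thesis .
qed

text \<open>The exponent \<open>s * \<bar>t\<bar> powr \<alpha>\<close> is the exponent at time 1
  evaluated at \<open>s powr (1 / \<alpha>) * t\<close>, and characteristic functions determine laws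
  on the line.\<close>

lemma marginal_scaling:
  assumes s: "0 < s" and b: "b \<in> Basis"
  shows "marginal s b = distr (marginal 1 b) borel (\<lambda>y. s powr (1 / \<alpha>) * y)"
proof -
  interpret m1: real_distribution "marginal 1 b" by (rule marginal_distribution) simp
  have d: "real_distribution (distr (marginal 1 b) borel (\<lambda>y. s powr (1 / \<alpha>) * y))"
    by (rule m1.real_distribution_distr) simp
  have "char (distr (marginal 1 b) borel (\<lambda>y. s powr (1 / \<alpha>) * y)) t = char (marginal s b) t" for t
  proof -
    have "char (distr (marginal 1 b) borel (\<lambda>y. s powr (1 / \<alpha>) * y)) t = char (marginal 1 b) (s powr (1 / \<alpha>) * t)"
      unfolding char_def by (subst integral_distr) (simp_all add: mult_ac)
    moreover have "\<bar>s powr (1 / \<alpha>) * t\<bar> powr \<alpha> = s * \<bar>t\<bar> powr \<alpha>"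
      using s \<alpha> by (simp add: abs_mult powr_mult powr_powr)
    ultimately show ?thesis using s b by (simp add: char_marginal mult_ac)
  qed
  then show ?thesis
    by (intro Levy_uniqueness marginal_distribution s d) (simp add: fun_eq_iff)
qed

text \<open>Cubes are used because leaving one means that some coordinate is large, which the
  marginals control.\<close>

definition cube :: "real \<Rightarrow> 'd set" where
  "cube r = {x. \<forall>b\<in>Basis. \<bar>x \<bullet> b\<bar> \<le> r}"

lemma cube_eq: "cube r = cbox (- (\<Sum>b\<in>Basis. r *\<^sub>R b)) (\<Sum>b\<in>Basis. r *\<^sub>R b)"
proof -
  have "\<bar>y\<bar> \<le> r \<longleftrightarrow> - r \<le> y \<and> y \<le> r" for y :: real by linarith
  then show ?thesis
    by (simp add: cube_def set_eq_iff mem_box inner_sum_left inner_Basis if_distrib sum.delta cong: if_cong)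
qed

lemma cube_measurable [measurable]: "cube r \<in> sets borel"
  by (simp add: cube_eq)

lemma emeasure_cube: "0 \<le> r \<Longrightarrow> emeasure lborel (cube r) = ennreal ((2 * r) ^ DIM('d))"
proof -
  assume r: "0 \<le> r"
  let ?u = "\<Sum>b\<in>(Basis::'d set). r *\<^sub>R b"
  have u: "?u \<bullet> b = r" if "b \<in> Basis" for b
    using that by (simp add: inner_sum_left inner_Basis if_distrib sum.delta cong: if_cong)
  then have "(\<Prod>b\<in>Basis. (?u - - ?u) \<bullet> b) = (\<Prod>b\<in>(Basis::'d set). 2 * r)"
    by (intro prod.cong) (auto simp: inner_add_left)
  then show ?thesis
    unfolding cube_eq emeasure_lborel_cbox_eq using u r by (auto simp: inner_minus_left)
qed

text \<open>Tightness of the finitely many marginals at time 1 gives \<open>R\<close>, and scaling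
  carries it to every \<open>s\<close>. Each coordinate may lose \<open>1 / (4 * DIM('d))\<close>,
  so the union bound loses at most a quarter. Allowing all larger \<open>r\<close> lets one cube
  serve a whole range of \<open>s\<close>.\<close>

lemma p_mass_cube:
  "\<exists>R>0. \<forall>s>0. \<forall>r\<ge>R * s powr (1 / \<alpha>). ennreal (3 / 4) \<le> (\<integral>\<^sup>+x\<in>cube r. ennreal (p s x) \<partial>lborel)"
proof -
  let ?\<epsilon> = "1 / (4 * DIM('d))"
  have tail: "\<forall>\<^sub>F n in sequentially. measure (marginal 1 b) {y. \<bar>y\<bar> \<le> real n} > 1 - ?\<epsilon>" for b :: 'd
  proof -
    interpret m1: real_distribution "marginal 1 b" by (rule marginal_distribution) simp
    have "(\<lambda>n. measure (marginal 1 b) {y. \<bar>y\<bar> \<le> real n}) \<longlonglongrightarrow> measure (marginal 1 b) (\<Union>n. {y. \<bar>y\<bar> \<le> real n})"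
      by (rule m1.finite_Lim_measure_incseq) (auto simp: incseq_def)
    moreover have "(\<Union>n. {y. \<bar>y\<bar> \<le> real n}) = space (marginal 1 b)"
      using real_arch_simple by auto
    ultimately have "(\<lambda>n. measure (marginal 1 b) {y. \<bar>y\<bar> \<le> real n}) \<longlonglongrightarrow> 1"
      using m1.prob_space by simp
    then show ?thesis by (rule order_tendstoD(1)) simp
  qed
  have "\<forall>\<^sub>F n in sequentially. \<forall>b\<in>(Basis::'d set). measure (marginal 1 b) {y. \<bar>y\<bar> \<le> real n} > 1 - ?\<epsilon>"
    by (rule eventually_ball_finite) (use tail in auto)
  then have "\<forall>\<^sub>F n in sequentially. n > 0 \<and> (\<forall>b\<in>(Basis::'d set). measure (marginal 1 b) {y. \<bar>y\<bar> \<le> real n} > 1 - ?\<epsilon>)"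
    using eventually_gt_at_top[of "0::nat"] by eventually_elim auto
  then obtain n :: nat where n: "n > 0"
    "\<And>b::'d. b \<in> Basis \<Longrightarrow> measure (marginal 1 b) {y. \<bar>y\<bar> \<le> real n} > 1 - ?\<epsilon>"
    by (auto simp: eventually_sequentially)
  have "ennreal (3 / 4) \<le> (\<integral>\<^sup>+x\<in>cube r. ennreal (p s x) \<partial>lborel)"
    if s: "s > 0" and r: "r \<ge> real n * s powr (1 / \<alpha>)" for s r
  proof -
    let ?P = "density lborel (\<lambda>x. ennreal (p s x))"
    interpret P: prob_space ?P
      by (rule prob_spaceI) (use s p_mass in \<open>simp add: emeasure_density\<close>)
    have mb: "P.prob {x. \<bar>x \<bullet> b\<bar> > r} \<le> ?\<epsilon>" if b: "b \<in> Basis" for b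
    proof -
      interpret m1: real_distribution "marginal 1 b" by (rule marginal_distribution) simp
      have "m1.prob {y. \<bar>y\<bar> \<le> real n} \<le> m1.prob {y. \<bar>s powr (1 / \<alpha>) * y\<bar> \<le> r}"
      proof (rule m1.finite_measure_mono)
        show "{y. \<bar>y\<bar> \<le> real n} \<subseteq> {y. \<bar>s powr (1 / \<alpha>) * y\<bar> \<le> r}"
        proof safe
          fix y :: real assume "\<bar>y\<bar> \<le> real n"
          then have "s powr (1 / \<alpha>) * \<bar>y\<bar> \<le> s powr (1 / \<alpha>) * real n" by (intro mult_left_mono) auto
          then show "\<bar>s powr (1 / \<alpha>) * y\<bar> \<le> r" using r by (simp add: abs_mult mult.commute)
        qed
      qed simp
      also have "\<dots> = measure (marginal s b) {y. \<bar>y\<bar> \<le> r}"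
        unfolding marginal_scaling[OF s b] by (subst measure_distr) auto
      also have "\<dots> = P.prob {x. \<bar>x \<bullet> b\<bar> \<le> r}"
        unfolding marginal_def by (subst measure_distr) (auto simp: vimage_def)
      finally have "P.prob {x. \<bar>x \<bullet> b\<bar> \<le> r} > 1 - ?\<epsilon>" using n(2)[OF b] by linarith
      moreover have "{x. \<bar>x \<bullet> b\<bar> > r} = space ?P - {x. \<bar>x \<bullet> b\<bar> \<le> r}" by auto
      moreover have "{x. \<bar>x \<bullet> b\<bar> \<le> r} \<in> sets ?P" by simp
      ultimately show ?thesis using P.prob_compl[of "{x. \<bar>x \<bullet> b\<bar> \<le> r}"] by simp
    qed
    have "P.prob (space ?P - cube r) \<le> P.prob (\<Union>b\<in>Basis. {x. \<bar>x \<bullet> b\<bar> > r})"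
      by (rule P.finite_measure_mono) (auto simp: cube_def not_le)
    also have "\<dots> \<le> (\<Sum>b\<in>Basis. P.prob {x. \<bar>x \<bullet> b\<bar> > r})"
      by (rule P.finite_measure_subadditive_finite) auto
    also have "\<dots> \<le> (\<Sum>b\<in>(Basis::'d set). ?\<epsilon>)" by (intro sum_mono mb)
    also have "\<dots> = 1 / 4" by simp
    finally have "P.prob (cube r) \<ge> 3 / 4" using P.prob_compl[of "cube r"] by simp
    then have "ennreal (3 / 4) \<le> emeasure ?P (cube r)"
      by (simp add: P.emeasure_eq_measure ennreal_leI)
    then show ?thesis using s by (simp add: emeasure_density)
  qed
  then show ?thesis using n(1) by (intro exI[of _ "real n"]) auto
qed

end

section \<open>The kernel\<close>

lemma lborel_distr_reflect: "distr lborel borel (\<lambda>y. x - y) = (lborel :: 'a::euclidean_space measure)"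
  using lborel_affine[of "-1" x] by (simp add: density_1)

lemma nn_integral_lborel_reflect:
  fixes q :: "'a::euclidean_space \<Rightarrow> ennreal"
  assumes "q \<in> borel_measurable borel"
  shows "(\<integral>\<^sup>+y. q (x - y) \<partial>lborel) = (\<integral>\<^sup>+y. q y \<partial>lborel)"
  using assms by (subst (2) lborel_distr_reflect[of x, symmetric]) (simp add: nn_integral_distr)

lemma has_bochner_integral_lborel_reflect:
  fixes q :: "'a::euclidean_space \<Rightarrow> real"
  assumes "q \<in> borel_measurable borel"
  shows "has_bochner_integral lborel (\<lambda>y. q (x - y)) a \<longleftrightarrow> has_bochner_integral lborel q a"
  using assms by (subst (2) lborel_distr_reflect[of x, symmetric])
    (simp add: has_bochner_integral_iff integrable_distr_eq integral_distr)

text \<open>The change of variables formula speaks about the gauge integral \<open>integral\<close>;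
  this translates its terms into nonnegative Lebesgue integrals.\<close>

lemma nn_integral_set_eq_integral:
  fixes q :: "real \<Rightarrow> real"
  assumes "set_integrable lborel S q" "\<And>s. s \<in> S \<Longrightarrow> 0 \<le> q s"
  shows "(\<integral>\<^sup>+s\<in>S. ennreal (q s) \<partial>lborel) = ennreal (integral S q)"
proof -
  have "(\<integral>\<^sup>+s\<in>S. ennreal (q s) \<partial>lborel) = (\<integral>\<^sup>+s. ennreal (indicator S s *\<^sub>R q s) \<partial>lborel)"
    by (intro nn_integral_cong) (auto split: split_indicator)
  also have "\<dots> = ennreal (LINT s:S|lborel. q s)"
    unfolding set_lebesgue_integral_def
    using assms by (intro nn_integral_eq_integral) (auto simp: set_integrable_def split: split_indicator)
  also have "\<dots> = ennreal (integral S q)"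
    using assms(1) by (simp add: set_borel_integral_eq_integral(2))
  finally show ?thesis .
qed

section \<open>The law of the inverse stable subordinator\<close>

context stable_kernel
begin

abbreviation fE :: "real \<Rightarrow> real \<Rightarrow> real" where
  "fE \<equiv> inverse_subordinator_density \<beta> g"

lemma fE_nonneg: "0 \<le> t \<Longrightarrow> 0 \<le> fE t s"
  unfolding inverse_subordinator_density_def using \<beta> g_nonneg by simp

lemma fE_measurable [measurable]: "fE t \<in> borel_measurable borel"
  unfolding inverse_subordinator_density_def[abs_def] by measurable

lemma g_mass: "integrable lborel g" "(LINT r|lborel. g r) = 1"
proof -
  show *: "(LINT r|lborel. g r) = 1" using g_laplace[of 0] \<beta> by simp
  then show "integrable lborel g" by (metis not_integrable_integral_eq zero_neq_one)
qed

text \<open>In probabilistic terms \<open>E\<^sub>t\<close> is distributed as \<open>(t / D\<^sub>1) powr \<beta>\<close>, and \<open>(t / r) powr \<beta> \<le> c\<close> means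
  \<open>r \<ge> t * c powr (- 1 / \<beta>)\<close>.\<close>

lemma fE_substitution:
  assumes t: "0 < t" and S: "S \<in> sets borel" "S \<subseteq> {0<..}"
    and S': "(\<lambda>s. t * s powr (- 1 / \<beta>)) ` S \<in> sets borel"
  shows "(\<integral>\<^sup>+s\<in>S. ennreal (fE t s) \<partial>lborel) = (\<integral>\<^sup>+r\<in>(\<lambda>s. t * s powr (- 1 / \<beta>)) ` S. ennreal (g r) \<partial>lborel)"
proof -
  let ?h = "\<lambda>s. t * s powr (- 1 / \<beta>)" and ?h' = "\<lambda>s. t * (- 1 / \<beta>) * s powr (- 1 / \<beta> - 1)"
  have der: "(?h has_field_derivative ?h' s) (at s within S)" if "s \<in> S" for s
    using that S(2) by (auto intro!: derivative_eq_intros)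
  have inj: "inj_on ?h S"
  proof (rule inj_onI)
    fix x y assume "x \<in> S" "y \<in> S" "?h x = ?h y"
    then have "x powr (- 1 / \<beta>) = y powr (- 1 / \<beta>)" "0 < x" "0 < y" using t S(2) by auto
    then have "(x powr (- 1 / \<beta>)) powr (- \<beta>) = (y powr (- 1 / \<beta>)) powr (- \<beta>)" by simp
    then show "x = y"
      using \<beta> \<open>0 < x\<close> \<open>0 < y\<close> by (simp add: powr_powr)
  qed
  have gi: "set_integrable lborel (?h ` S) g"
    unfolding set_integrable_def by (rule integrable_mult_indicator) (use S' g_mass in auto)
  then have "g absolutely_integrable_on (?h ` S)"
    by (simp add: set_integrable_def integrable_completion)
  moreover have "S \<in> sets lebesgue" using S(1) by simp
  ultimately have *: "(\<lambda>s. \<bar>?h' s\<bar> * g (?h s)) absolutely_integrable_on S \<and>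
      integral S (\<lambda>s. \<bar>?h' s\<bar> * g (?h s)) = integral (?h ` S) g"
    using has_absolute_integral_change_of_variables_1'[OF _ der inj, of g "integral (?h ` S) g"] by blast
  \<comment> \<open>The modulus of the derivative is exactly the prefactor in the density of
    \<open>E_t\<close>.\<close>
  have eq: "\<bar>?h' s\<bar> * g (?h s) = fE t s" if "s \<in> S" for s
  proof -
    have e: "- (1 / \<beta>) - 1 = - 1 - 1 / \<beta>" by simp
    show ?thesis
      using t \<beta> by (simp add: inverse_subordinator_density_def abs_mult e)
  qed
  have ff: "fE t absolutely_integrable_on S" "integral S (fE t) = integral (?h ` S) g"
    using * eq set_integrable_cong[of lebesgue lebesgue S S "\<lambda>s. \<bar>?h' s\<bar> * g (?h s)" "fE t"]
      integral_cong[of S "\<lambda>s. \<bar>?h' s\<bar> * g (?h s)" "fE t"] by auto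
  have fi: "set_integrable lborel S (fE t)"
    using ff(1) S(1) by (simp add: set_integrable_def integrable_completion)
  have "(\<integral>\<^sup>+s\<in>S. ennreal (fE t s) \<partial>lborel) = ennreal (integral S (fE t))"
    using fi t fE_nonneg by (intro nn_integral_set_eq_integral) auto
  also have "\<dots> = ennreal (integral (?h ` S) g)" by (simp add: ff(2))
  also have "\<dots> = (\<integral>\<^sup>+r\<in>?h ` S. ennreal (g r) \<partial>lborel)"
    using gi g_nonneg by (intro nn_integral_set_eq_integral[symmetric]) auto
  finally show ?thesis .
qed

lemma substitution_image:
  assumes t: "0 < t"
  shows "(\<lambda>s. t * s powr (- 1 / \<beta>)) ` {0<..} = {0<..}"
    and "0 < r0 \<Longrightarrow> (\<lambda>s. t * s powr (- 1 / \<beta>)) ` {0<..(t / r0) powr \<beta>} = {r0..}"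
proof -
  let ?h = "\<lambda>s. t * s powr (- 1 / \<beta>)"
  have inv: "?h ((t / r) powr \<beta>) = r" if "0 < r" for r
    using that t \<beta> by (simp add: powr_powr powr_minus divide_simps)
  show "?h ` {0<..} = {0<..}"
  proof safe
    fix r :: real assume "0 < r"
    then show "r \<in> ?h ` {0<..}" using inv[of r] t by (intro image_eqI[of _ _ "(t / r) powr \<beta>"]) auto
  qed (use t in auto)
  assume r0: "0 < r0"
  show "?h ` {0<..(t / r0) powr \<beta>} = {r0..}"
  proof safe
    fix s assume s: "s \<in> {0<..(t / r0) powr \<beta>}"
    then have "((t / r0) powr \<beta>) powr (- 1 / \<beta>) \<le> s powr (- 1 / \<beta>)"
      using \<beta> by (intro powr_mono2') auto
    then have "?h ((t / r0) powr \<beta>) \<le> ?h s" using t by simp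
    then show "r0 \<le> ?h s" using inv[OF r0] by simp
  next
    fix r assume r: "r0 \<le> r"
    then have "(t / r) powr \<beta> \<le> (t / r0) powr \<beta>"
      using r0 t \<beta> by (intro powr_mono2) (auto intro: divide_left_mono)
    then show "r \<in> ?h ` {0<..(t / r0) powr \<beta>}"
      using inv[of r] r r0 t by (intro image_eqI[of _ _ "(t / r) powr \<beta>"]) auto
  qed
qed

lemma g_nn_mass: "(\<integral>\<^sup>+r\<in>{0<..}. ennreal (g r) \<partial>lborel) = 1"
proof -
  have "(\<integral>\<^sup>+r\<in>{0<..}. ennreal (g r) \<partial>lborel) = (\<integral>\<^sup>+r. ennreal (g r) \<partial>lborel)"
    by (intro nn_integral_cong) (auto simp: g_nonpos split: split_indicator)
  also have "\<dots> = 1" using g_mass g_nonneg by (simp add: nn_integral_eq_integral)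
  finally show ?thesis .
qed

lemma fE_mass: "0 < t \<Longrightarrow> (\<integral>\<^sup>+s\<in>{0<..}. ennreal (fE t s) \<partial>lborel) = 1"
  using fE_substitution[of t "{0<..}"] substitution_image(1)[of t] g_nn_mass by simp

text \<open>All mass of \<open>g\<close> lies in \<open>{0<..}\<close>, which is exhausted by the
  sets \<open>?A n\<close>, so one of them carries more than half. The choice involves
  \<open>g\<close> alone, whence \<open>r0\<close> is the same for all \<open>t\<close>.\<close>

lemma fE_mass_near_0:
  "\<exists>r0>0. \<forall>t>0. ennreal (1 / 2) \<le> (\<integral>\<^sup>+s\<in>{0<..(t / r0) powr \<beta>}. ennreal (fE t s) \<partial>lborel)"
proof -
  let ?P = "density lborel (\<lambda>r. ennreal (g r))"
  let ?A = "\<lambda>n. {1 / real (Suc n)..}"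
  have "(\<lambda>n. emeasure ?P (?A n)) \<longlonglongrightarrow> emeasure ?P (\<Union>n. ?A n)"
    by (rule Lim_emeasure_incseq) (auto simp: incseq_def intro: order_trans[rotated] simp: frac_le)
  moreover have "(\<Union>n. ?A n) = {0<..}"
  proof safe
    fix r :: real assume "0 < r"
    then obtain n where "inverse (real (Suc n)) < r" using reals_Archimedean by blast
    then show "r \<in> (\<Union>n. ?A n)" by (auto simp: inverse_eq_divide intro: less_imp_le)
  next
    fix r :: real and n assume "1 / real (Suc n) \<le> r"
    then show "0 < r" by (rule less_le_trans[rotated]) simp
  qed
  ultimately have "(\<lambda>n. emeasure ?P (?A n)) \<longlonglongrightarrow> 1"
    using g_nn_mass by (simp add: emeasure_density)
  then have "\<forall>\<^sub>F n in sequentially. emeasure ?P (?A n) > ennreal (1 / 2)"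
    by (rule order_tendstoD(1)) (rule ennreal_lessI[of 1 "1 / 2", unfolded ennreal_1]; simp)
  then obtain n where n: "emeasure ?P (?A n) > ennreal (1 / 2)"
    by (auto simp: eventually_sequentially)
  let ?r = "1 / real (Suc n)"
  have r: "?r > 0" by simp
  have "ennreal (1 / 2) \<le> (\<integral>\<^sup>+s\<in>{0<..(t / ?r) powr \<beta>}. ennreal (fE t s) \<partial>lborel)" if t: "t > 0" for t
  proof -
    have "(\<integral>\<^sup>+s\<in>{0<..(t / ?r) powr \<beta>}. ennreal (fE t s) \<partial>lborel) = emeasure ?P (?A n)"
      using substitution_image(2)[OF t r]
      by (subst fE_substitution[OF t]) (auto simp: emeasure_density)
    then show ?thesis using n by simp
  qed
  with r show ?thesis by blast
qed

section \<open>Mass and L2 norm of the kernel\<close>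

abbreviation G :: "real \<Rightarrow> 'd \<Rightarrow> real" where
  "G \<equiv> kernel \<beta> p g"

lemma kernel_integrand_measurable:
  "(\<lambda>(x, s). indicator {0<..} s * (p s x * fE t s)) \<in> borel_measurable (borel \<Otimes>\<^sub>M borel)"
proof -
  have "(\<lambda>(x::'d, s::real). (s, x)) \<in> borel \<Otimes>\<^sub>M borel \<rightarrow>\<^sub>M borel \<Otimes>\<^sub>M borel" by measurable
  from measurable_compose[OF this p_measurable_joint]
  have "(\<lambda>z. indicator {0<..} (snd z) * p (snd z) (fst z)) \<in> borel_measurable (borel \<Otimes>\<^sub>M borel)"
    by (simp add: case_prod_beta')
  then have "(\<lambda>z. indicator {0<..} (snd z) * p (snd z) (fst z) * fE t (snd z)) \<in> borel_measurable (borel \<Otimes>\<^sub>M borel)"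
    by measurable
  then show ?thesis by (simp add: case_prod_beta' mult_ac)
qed

lemma G_measurable [measurable]: "G t \<in> borel_measurable borel"
proof -
  have "(\<lambda>x. LINT s|lborel. indicator {0<..} s * (p s x * fE t s)) \<in> borel_measurable borel"
    using kernel_integrand_measurable[of t]
    by (intro lborel.borel_measurable_lebesgue_integral) simp
  then show ?thesis by (simp add: kernel_def[abs_def] set_lebesgue_integral_def)
qed

lemma G_nonneg: "0 \<le> t \<Longrightarrow> 0 \<le> G t x"
  unfolding kernel_def set_lebesgue_integral_def
  by (intro Bochner_Integration.integral_nonneg) (auto simp: p_nonneg fE_nonneg split: split_indicator)

text \<open>Tonelli for the extended-valued inner integral, which agrees with \<open>G\<close> only
  almost everywhere.\<close>

lemma nn_integral_kernel_swap:
  assumes t: "0 < t" and B: "B \<in> sets borel"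
  shows "(\<integral>\<^sup>+x\<in>B. (\<integral>\<^sup>+s. ennreal (indicator {0<..} s * (p s x * fE t s)) \<partial>lborel) \<partial>lborel) =
    (\<integral>\<^sup>+s\<in>{0<..}. ennreal (fE t s) * (\<integral>\<^sup>+x\<in>B. ennreal (p s x) \<partial>lborel) \<partial>lborel)"
proof -
  let ?k = "\<lambda>x s. ennreal (indicator {0<..} s * (p s x * fE t s))"
  have k: "(\<lambda>(x, s). ?k x s) \<in> borel_measurable (lborel \<Otimes>\<^sub>M lborel)"
    using measurable_compose[OF kernel_integrand_measurable[of t] measurable_ennreal]
    by (simp add: case_prod_beta' comp_def)
  have k1: "?k x \<in> borel_measurable lborel" for x
    using measurable_compose[OF measurable_Pair1' k, of x] by simp
  have "(\<integral>\<^sup>+x\<in>B. (\<integral>\<^sup>+s. ?k x s \<partial>lborel) \<partial>lborel) = (\<integral>\<^sup>+x. (\<integral>\<^sup>+s. ?k x s * indicator B x \<partial>lborel) \<partial>lborel)"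
    using k1 by (simp add: nn_integral_multc)
  also have "\<dots> = (\<integral>\<^sup>+s. (\<integral>\<^sup>+x. ?k x s * indicator B x \<partial>lborel) \<partial>lborel)"
  proof (rule lborel_pair.Fubini'[symmetric])
    have "(\<lambda>z. (\<lambda>(x, s). ?k x s) z * indicator B (fst z)) \<in> borel_measurable (lborel \<Otimes>\<^sub>M lborel)"
      using B by (intro borel_measurable_times_ennreal k) simp
    then show "(\<lambda>(x, s). ?k x s * indicator B x) \<in> borel_measurable (lborel \<Otimes>\<^sub>M lborel)"
      by (simp add: case_prod_beta')
  qed
  also have "\<dots> = (\<integral>\<^sup>+s\<in>{0<..}. ennreal (fE t s) * (\<integral>\<^sup>+x\<in>B. ennreal (p s x) \<partial>lborel) \<partial>lborel)"
  proof (rule nn_integral_cong)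
    fix s :: real
    show "(\<integral>\<^sup>+x. ?k x s * indicator B x \<partial>lborel) =
        (ennreal (fE t s) * (\<integral>\<^sup>+x\<in>B. ennreal (p s x) \<partial>lborel)) * indicator {0<..} s"
    proof (cases "0 < s")
      case True
      then have "(\<integral>\<^sup>+x. ?k x s * indicator B x \<partial>lborel) =
          (\<integral>\<^sup>+x. ennreal (fE t s) * (ennreal (p s x) * indicator B x) \<partial>lborel)"
        using t by (intro nn_integral_cong) (simp add: ennreal_mult' fE_nonneg p_nonneg mult_ac)
      with True B show ?thesis by (simp add: nn_integral_cmult)
    qed simp
  qed
  finally show ?thesis .
qed

text \<open>Where the integral defining the kernel diverges, \<open>G\<close> has the junk value 0; this happens only
  on a null set.\<close>

lemma G_AE:
  assumes t: "0 < t"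
  shows "AE x in lborel. ennreal (G t x) = (\<integral>\<^sup>+s. ennreal (indicator {0<..} s * (p s x * fE t s)) \<partial>lborel)"
proof -
  let ?k = "\<lambda>x s. indicator {0<..} s * (p s x * fE t s)"
  let ?K = "\<lambda>x. \<integral>\<^sup>+s. ennreal (?k x s) \<partial>lborel"
  have k: "(\<lambda>(x, s). ennreal (?k x s)) \<in> borel_measurable (lborel \<Otimes>\<^sub>M lborel)"
    using measurable_compose[OF kernel_integrand_measurable[of t] measurable_ennreal]
    by (simp add: case_prod_beta' comp_def)
  have km: "?k x \<in> borel_measurable lborel" for x
    using measurable_compose[OF measurable_Pair1' kernel_integrand_measurable[of t], of x] by simp
  have "(\<integral>\<^sup>+x\<in>UNIV. ?K x \<partial>lborel) = 1"
  proof -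
    have "(\<integral>\<^sup>+x\<in>UNIV. ?K x \<partial>lborel) = (\<integral>\<^sup>+s\<in>{0<..}. ennreal (fE t s) \<partial>lborel)"
      using p_mass by (subst nn_integral_kernel_swap[OF t])
        (auto intro!: nn_integral_cong split: split_indicator)
    then show ?thesis using fE_mass[OF t] by simp
  qed
  then have "(\<integral>\<^sup>+x. ?K x \<partial>lborel) \<noteq> \<infinity>" by simp
  moreover have "?K \<in> borel_measurable lborel"
    using k by (intro lborel.borel_measurable_nn_integral) simp
  ultimately have "AE x in lborel. ?K x \<noteq> \<infinity>" by (intro nn_integral_PInf_AE)
  then show ?thesis
  proof eventually_elim
    case (elim x)
    have nn: "0 \<le> ?k x s" for s
      using t by (auto simp: p_nonneg fE_nonneg split: split_indicator)
    then have "integrable lborel (?k x)"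
      using elim km by (intro integrableI_nonneg) (auto simp: top.not_eq_extremum)
    then have "?K x = ennreal (LINT s|lborel. ?k x s)"
      using nn by (intro nn_integral_eq_integral) auto
    then show ?case by (simp add: kernel_def set_lebesgue_integral_def)
  qed
qed

lemma nn_integral_G:
  assumes t: "0 < t" and B: "B \<in> sets borel"
  shows "(\<integral>\<^sup>+x\<in>B. ennreal (G t x) \<partial>lborel) =
    (\<integral>\<^sup>+s\<in>{0<..}. ennreal (fE t s) * (\<integral>\<^sup>+x\<in>B. ennreal (p s x) \<partial>lborel) \<partial>lborel)"
  unfolding nn_integral_kernel_swap[OF t B, symmetric]
  using G_AE[OF t] by (intro nn_integral_cong_AE) auto

lemma G_mass:
  assumes t: "0 < t"
  shows "integrable lborel (G t)" "(LINT x|lborel. G t x) = 1"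
proof -
  have "(\<integral>\<^sup>+x\<in>UNIV. ennreal (G t x) \<partial>lborel) = (\<integral>\<^sup>+s\<in>{0<..}. ennreal (fE t s) \<partial>lborel)"
    using p_mass by (subst nn_integral_G[OF t]) (auto intro!: nn_integral_cong split: split_indicator)
  then have *: "(\<integral>\<^sup>+x. ennreal (G t x) \<partial>lborel) = 1" using fE_mass[OF t] by simp
  then show "integrable lborel (G t)"
    using G_nonneg t by (intro integrableI_nonneg) auto
  show "(LINT x|lborel. G t x) = 1"
    using * G_nonneg t by (subst integral_eq_nn_integral) auto
qed

text \<open>An average with weights of total mass 1. Boundedness of \<open>u0\<close> makes the
  integrand integrable, so that the integral is not the default value 0.\<close>

lemma kernel_average_ge:
  fixes u0 :: "'d \<Rightarrow> real"
  assumes t: "0 < t" and u0: "u0 \<in> borel_measurable borel" "bounded (range u0)" and c: "\<And>x. c \<le> u0 x"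
  shows "c \<le> (LINT y|lborel. G t (x - y) * u0 y)"
proof -
  have 1: "has_bochner_integral lborel (\<lambda>y. G t (x - y)) 1"
    using G_mass[OF t] by (subst has_bochner_integral_lborel_reflect) (auto simp: has_bochner_integral_iff)
  obtain K where K: "\<And>y. \<bar>u0 y\<bar> \<le> K" using u0(2) by (auto simp: bounded_iff)
  have "integrable lborel (\<lambda>y. G t (x - y) * u0 y)"
  proof (rule Bochner_Integration.integrable_bound)
    show "integrable lborel (\<lambda>y. G t (x - y) * K)"
      using 1 by (auto simp: has_bochner_integral_iff)
    show "AE y in lborel. norm (G t (x - y) * u0 y) \<le> norm (G t (x - y) * K)"
      using order_trans[OF K abs_ge_self] by (auto intro!: AE_I2 mult_left_mono simp: abs_mult)
  qed (use u0 in measurable)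
  moreover have 2: "has_bochner_integral lborel (\<lambda>y. G t (x - y) * c) (1 * c)"
    by (intro has_bochner_integral_mult_left) (use 1 in simp)
  ultimately have "(LINT y|lborel. G t (x - y) * c) \<le> (LINT y|lborel. G t (x - y) * u0 y)"
    using G_nonneg t c by (intro integral_mono) (auto simp: has_bochner_integral_iff mult_left_mono)
  then show ?thesis using has_bochner_integral_integral_eq[OF 2] by linarith
qed

lemma G_L2_lower_bound:
  "\<exists>c>0. \<forall>t>0. ennreal (c * t powr (- (\<beta> * DIM('d) / \<alpha>))) \<le> (\<integral>\<^sup>+x. ennreal ((G t x)\<^sup>2) \<partial>lborel)"
proof -
  obtain R where R: "R > 0"
    "\<And>s r. s > 0 \<Longrightarrow> r \<ge> R * s powr (1 / \<alpha>) \<Longrightarrow> ennreal (3 / 4) \<le> (\<integral>\<^sup>+x\<in>cube r. ennreal (p s x) \<partial>lborel)"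
    using p_mass_cube by blast
  obtain r0 where r0: "r0 > 0"
    "\<And>t. t > 0 \<Longrightarrow> ennreal (1 / 2) \<le> (\<integral>\<^sup>+s\<in>{0<..(t / r0) powr \<beta>}. ennreal (fE t s) \<partial>lborel)"
    using fE_mass_near_0 by blast
  define k where "k = 2 * R / r0 powr (\<beta> / \<alpha>)"
  have k: "k > 0" using R r0 by (simp add: k_def)
  have "ennreal (9 / 64 / k ^ DIM('d) * t powr (- (\<beta> * DIM('d) / \<alpha>))) \<le> (\<integral>\<^sup>+x. ennreal ((G t x)\<^sup>2) \<partial>lborel)"
    (is "_ \<le> ?I") if t: "t > 0" for t
  proof -
    \<comment> \<open>The radius \<open>R * s powr (1 / \<alpha>)\<close> at the largest
      \<open>s\<close> in \<open>?S\<close>; the cube therefore works for all of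
      \<open>?S\<close>.\<close>
    define r where "r = R * ((t / r0) powr \<beta>) powr (1 / \<alpha>)"
    have r: "2 * r = k * t powr (\<beta> / \<alpha>)"
      using t r0 by (simp add: r_def k_def powr_powr powr_divide)
    have r_nn: "0 \<le> r" using R by (simp add: r_def)
    let ?S = "{0<..(t / r0) powr \<beta>}"
    \<comment> \<open>Half of the mass in \<open>s\<close> times three quarters of the mass in
      space; the square of this is the constant 9/64.\<close>
    have "ennreal (3 / 8) = ennreal (1 / 2) * ennreal (3 / 4)"
      by (subst ennreal_mult[symmetric]) auto
    also have "\<dots> \<le> (\<integral>\<^sup>+s\<in>?S. ennreal (fE t s) \<partial>lborel) * ennreal (3 / 4)"
      by (intro mult_right_mono r0 t) simp
    also have "\<dots> = (\<integral>\<^sup>+s. ennreal (fE t s) * indicator ?S s * ennreal (3 / 4) \<partial>lborel)"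
      by (rule nn_integral_multc[symmetric]) measurable
    also have "\<dots> \<le> (\<integral>\<^sup>+s\<in>{0<..}. ennreal (fE t s) * (\<integral>\<^sup>+x\<in>cube r. ennreal (p s x) \<partial>lborel) \<partial>lborel)"
    proof (rule nn_integral_mono)
      fix s :: real
      show "ennreal (fE t s) * indicator ?S s * ennreal (3 / 4) \<le>
          ennreal (fE t s) * (\<integral>\<^sup>+x\<in>cube r. ennreal (p s x) \<partial>lborel) * indicator {0<..} s"
      proof (cases "s \<in> ?S")
        case True
        then have "R * s powr (1 / \<alpha>) \<le> r"
          unfolding r_def using R(1) \<alpha> by (intro mult_left_mono powr_mono2) auto
        with True R(2)[of s r] show ?thesis by (auto intro: mult_left_mono)
      qed simp
    qed
    also have "\<dots> = (\<integral>\<^sup>+x\<in>cube r. ennreal (G t x) \<partial>lborel)"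
      by (rule nn_integral_G[OF t, symmetric]) measurable
    finally have "(ennreal (3 / 8))\<^sup>2 \<le> (\<integral>\<^sup>+x\<in>cube r. ennreal (G t x) \<partial>lborel)\<^sup>2"
      by (rule power_mono) simp
    also have "\<dots> \<le> (\<integral>\<^sup>+x. (ennreal (G t x))\<^sup>2 \<partial>lborel) * (\<integral>\<^sup>+x. (indicator (cube r) x)\<^sup>2 \<partial>lborel)"
      by (rule Cauchy_Schwarz_nn_integral) measurable
    also have "\<dots> = ?I * ennreal ((2 * r) ^ DIM('d))"
    proof -
      have "(\<integral>\<^sup>+x. (indicator (cube r) x)\<^sup>2 \<partial>lborel) = (\<integral>\<^sup>+x. indicator (cube r) x \<partial>lborel)"
        by (intro nn_integral_cong) (auto split: split_indicator)
      then show ?thesis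
        using G_nonneg t by (simp add: emeasure_cube[OF r_nn] ennreal_power)
    qed
    also have "(2 * r) ^ DIM('d) = k ^ DIM('d) * t powr (\<beta> * DIM('d) / \<alpha>)"
      unfolding r using t by (simp add: power_mult_distrib powr_powr flip: powr_realpow)
    finally have *: "(ennreal (3 / 8))\<^sup>2 \<le> ?I * ennreal (k ^ DIM('d) * t powr (\<beta> * DIM('d) / \<alpha>))" .
    \<comment> \<open>The volume of the cube, by which the Cauchy-Schwarz bound is divided.\<close>
    let ?m = "k ^ DIM('d) * t powr (\<beta> * DIM('d) / \<alpha>)"
    have m: "?m > 0" using k t by simp
    have "ennreal (9 / 64 / k ^ DIM('d) * t powr (- (\<beta> * DIM('d) / \<alpha>))) = ennreal (9 / 64 * (1 / ?m))"
      by (simp add: powr_minus field_simps)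
    also have "\<dots> = (ennreal (3 / 8))\<^sup>2 * ennreal (1 / ?m)"
      using m by (simp only: ennreal_mult'[symmetric] ennreal_power) (simp add: power2_eq_square flip: ennreal_mult')
    also have "\<dots> \<le> ?I * ennreal ?m * ennreal (1 / ?m)"
      by (intro mult_right_mono *) simp
    also have "\<dots> = ?I"
      using m k t by (simp add: mult.assoc flip: ennreal_mult)
    finally show ?thesis .
  qed
  then show ?thesis using k by (intro exI[of _ "9 / 64 / k ^ DIM('d)"]) auto
qed

end

section \<open>Blow-up\<close>

text \<open>Young's inequality for the product \<open>w * 1\<close> with conjugate exponents
  \<open>q\<close> and \<open>q / (q - 1)\<close>: the power function lies above its tangent at
  1.\<close>

lemma bernoulli_inequality_powr:
  fixes w q :: real
  assumes "0 \<le> w" "1 < q"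
  shows "1 + q * (w - 1) \<le> w powr q"
proof -
  have "w * 1 \<le> w powr q / q + 1 powr (q / (q - 1)) / (q / (q - 1))"
    using assms by (intro Youngs_inequality) (auto simp: field_simps)
  also have "\<dots> = (w powr q + q - 1) / q"
    using assms by (simp add: add_divide_distrib diff_divide_distrib)
  finally show ?thesis using assms by (simp add: pos_le_divide_eq algebra_simps)
qed

text \<open>Jensen's inequality in the form of its supporting line at \<open>A\<close>, so that the second moment
  need not be finite.\<close>

lemma (in prob_space) second_moment_powr:
  fixes Z :: "'a \<Rightarrow> real"
  assumes Z: "Z \<in> borel_measurable M" and A: "0 < A" and q: "1 < q"
    and le: "ennreal A \<le> (\<integral>\<^sup>+\<omega>. ennreal (\<bar>Z \<omega>\<bar>\<^sup>2) \<partial>M)"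
  shows "ennreal (A powr q) \<le> (\<integral>\<^sup>+\<omega>. ennreal ((\<bar>Z \<omega>\<bar> powr q)\<^sup>2) \<partial>M)"
proof -
  let ?k = "q * A powr (q - 1)"
  have k: "?k * A = q * A powr q" using A by (simp add: powr_diff)
  \<comment> \<open>The tangent at \<open>A\<close>, with slope \<open>?k\<close>, arranged with
    nonnegative terms on both sides so that it can be integrated in \<open>ennreal\<close>; the
    finite term \<open>?k * A\<close> is cancelled at the end.\<close>
  have pt: "A powr q + ?k * \<bar>z\<bar>\<^sup>2 \<le> (\<bar>z\<bar> powr q)\<^sup>2 + ?k * A" for z :: real
  proof -
    have "1 + q * (\<bar>z\<bar>\<^sup>2 / A - 1) \<le> (\<bar>z\<bar>\<^sup>2 / A) powr q"
      by (rule bernoulli_inequality_powr) (use A q in auto)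
    then have "A powr q * (1 + q * (\<bar>z\<bar>\<^sup>2 / A - 1)) \<le> A powr q * (\<bar>z\<bar>\<^sup>2 / A) powr q"
      by (intro mult_left_mono) auto
    also have "\<dots> = (\<bar>z\<bar>\<^sup>2) powr q"
      using A by (simp flip: powr_mult)
    also have "\<dots> = (\<bar>z\<bar> powr q)\<^sup>2"
      by (simp only: power2_eq_square powr_mult abs_ge_zero)
    finally show ?thesis
      using A by (simp add: algebra_simps powr_diff)
  qed
  have "ennreal (A powr q) + ennreal (?k * A) = ennreal (A powr q) + ennreal ?k * ennreal A"
    using A q by (simp add: ennreal_mult)
  also have "\<dots> \<le> ennreal (A powr q) + ennreal ?k * (\<integral>\<^sup>+\<omega>. ennreal (\<bar>Z \<omega>\<bar>\<^sup>2) \<partial>M)"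
    by (intro add_left_mono mult_left_mono le) simp
  also have "\<dots> = (\<integral>\<^sup>+\<omega>. ennreal (A powr q) + ennreal ?k * ennreal (\<bar>Z \<omega>\<bar>\<^sup>2) \<partial>M)"
    using Z by (simp add: nn_integral_add nn_integral_cmult emeasure_space_1)
  also have "\<dots> \<le> (\<integral>\<^sup>+\<omega>. ennreal ((\<bar>Z \<omega>\<bar> powr q)\<^sup>2) + ennreal (?k * A) \<partial>M)"
  proof (rule nn_integral_mono)
    fix \<omega>
    have "ennreal (A powr q) + ennreal ?k * ennreal (\<bar>Z \<omega>\<bar>\<^sup>2) = ennreal (A powr q + ?k * \<bar>Z \<omega>\<bar>\<^sup>2)"
      using A q by (simp add: ennreal_mult)
    also have "\<dots> \<le> ennreal ((\<bar>Z \<omega>\<bar> powr q)\<^sup>2 + ?k * A)"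
      by (intro ennreal_leI pt)
    also have "\<dots> = ennreal ((\<bar>Z \<omega>\<bar> powr q)\<^sup>2) + ennreal (?k * A)"
      using A q by simp
    finally show "ennreal (A powr q) + ennreal ?k * ennreal (\<bar>Z \<omega>\<bar>\<^sup>2) \<le>
        ennreal ((\<bar>Z \<omega>\<bar> powr q)\<^sup>2) + ennreal (?k * A)" .
  qed
  also have "\<dots> = (\<integral>\<^sup>+\<omega>. ennreal ((\<bar>Z \<omega>\<bar> powr q)\<^sup>2) \<partial>M) + ennreal (?k * A)"
    using Z by (simp add: nn_integral_add emeasure_space_1)
  finally show ?thesis
    unfolding add.commute[of _ "ennreal (?k * A)"] ennreal_add_left_cancel_le by auto
qed

text \<open>The lower bound is multiplied by \<open>l > 1\<close> over each of the intervals of length \<open>2 ^ (- n)\<close>;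
  the constant \<open>B\<close> is chosen such that \<open>K * B powr (q - 1) = l\<close>.\<close>

lemma superlinear_blow_up:
  fixes F :: "real \<Rightarrow> 'x \<Rightarrow> ennreal"
  assumes K: "0 < K" and q: "1 < q" and e: "0 < e" and a: "0 < a"
    and base: "\<And>t x. 0 < t \<Longrightarrow> ennreal a \<le> F t x"
    and step: "\<And>A T d t x. 0 < A \<Longrightarrow> 0 \<le> T \<Longrightarrow> 0 < d \<Longrightarrow> (\<And>t x. T < t \<Longrightarrow> ennreal A \<le> F t x) \<Longrightarrow>
      T + d < t \<Longrightarrow> ennreal (K * A powr q * d powr e) \<le> F t x"
  shows "\<exists>T\<ge>0. \<forall>t>T. \<forall>x. F t x = \<infinity>"
proof -
  \<comment> \<open>The gain \<open>(l powr (q - 1)) ^ n = 2 powr (e * n)\<close> exactly offsets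
    the loss from the step length \<open>2 ^ (- n)\<close> raised to the power
    \<open>e\<close>.\<close>
  define l where "l = 2 powr (e / (q - 1))"
  define B where "B = (l / K) powr (1 / (q - 1))"
  \<comment> \<open>The length of the first step, solving
    \<open>K * a powr q * T powr e = B\<close>: from time 0 it lifts the bound \<open>a\<close> to
    \<open>B\<close>.\<close>
  define T where "T = (B / (K * a powr q)) powr (1 / e)"
  have l: "l > 1" and lq: "l powr (q - 1) = 2 powr e"
    using q e by (auto simp: l_def powr_powr gr_one_powr)
  have B: "B > 0" and Bq: "K * B powr (q - 1) = l"
    using K q l by (auto simp: B_def powr_powr)
  have T: "T > 0" and Te: "K * a powr q * T powr e = B"
    using K a B e by (auto simp: T_def powr_powr)
  have P: "ennreal (B * l ^ n) \<le> F t x" if "T + (\<Sum>k<n. (1 / 2) ^ k) < t" for n t x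
    using that
  proof (induction n arbitrary: t x)
    case 0
    then show ?case using step[of a 0 T t x] a T base by (simp add: Te)
  next
    case (Suc n)
    let ?A = "B * l ^ n" and ?d = "(1 / 2 :: real) ^ n"
    have A: "?A > 0" using B l by simp
    have "ennreal (K * ?A powr q * ?d powr e) \<le> F t x"
    proof (rule step[OF A])
      show "0 \<le> T + (\<Sum>k<n. (1 / 2) ^ k)" using T by (simp add: sum_nonneg)
      show "T + (\<Sum>k<n. (1 / 2) ^ k) + ?d < t" using Suc.prems by simp
    qed (use Suc.IH in auto)
    also have "K * ?A powr q * ?d powr e = B * l ^ Suc n"
    proof -
      have "?A powr q = ?A * ?A powr (q - 1)" using A by (simp add: powr_diff)
      also have "?A powr (q - 1) = B powr (q - 1) * (l powr (q - 1)) ^ n"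
        using B l by (simp add: powr_mult powr_power powr_powr mult.commute flip: powr_realpow)
      finally have "K * ?A powr q * ?d powr e = ?A * (K * B powr (q - 1)) * (2 powr e) ^ n * ?d powr e"
        by (simp add: lq)
      moreover have "?d powr e = 1 / (2 powr e) ^ n"
        by (simp add: powr_divide powr_powr mult.commute flip: powr_realpow power_one_over)
      ultimately show ?thesis by (simp add: Bq mult_ac)
    qed
    finally show ?case .
  qed
  have "F t x = \<infinity>" if t: "T + 2 < t" for t x
  proof (rule ccontr)
    assume "F t x \<noteq> \<infinity>"
    then obtain r where r: "F t x = ennreal r" "r \<ge> 0" by (cases "F t x") auto
    obtain n where n: "r / B < l ^ n" using real_arch_pow[OF l] by blast
    \<comment> \<open>The steps after \<open>T\<close> last at most 2 in total, so beyond
      \<open>T + 2\<close> the bounds for all \<open>n\<close> hold at once.\<close>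
    have "(\<Sum>k<n. (1 / 2 :: real) ^ k) \<le> 2"
      unfolding sum_gp_strict by simp
    then have "ennreal (B * l ^ n) \<le> ennreal r" using P[of n t x] t r by simp
    then have "B * l ^ n \<le> r" using r by (simp add: ennreal_le_iff)
    then show False using n B by (simp add: field_simps)
  qed
  then show ?thesis using T by (intro exI[of _ "T + 2"]) auto
qed

section \<open>Second moments of a mild solution\<close>

lemma (in levy_noise) mild_solution_second_moment:
  assumes u: "mild_solution M mu N G \<sigma> u0 u" and t: "0 < t"
  shows "ennreal ((LINT y|lborel. G t (x - y) * u0 y)\<^sup>2) +
      integrand_sq_norm M mu t (\<lambda>s y h \<omega>. G (t - s) (x - y) * \<sigma> (u s y \<omega>) h)
    \<le> (\<integral>\<^sup>+\<omega>. ennreal (\<bar>u t x \<omega>\<bar>\<^sup>2) \<partial>M)"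
proof -
  obtain I where I: "has_compensated_integral M mu N t (\<lambda>s y h \<omega>. G (t - s) (x - y) * \<sigma> (u s y \<omega>) h) I"
    and ae: "AE \<omega> in M. u t x \<omega> = (LINT y|lborel. G t (x - y) * u0 y) + I \<omega>"
    using u t unfolding mild_solution_def by blast
  have "(\<integral>\<^sup>+\<omega>. ennreal (\<bar>u t x \<omega>\<bar>\<^sup>2) \<partial>M) =
      (\<integral>\<^sup>+\<omega>. ennreal (((LINT y|lborel. G t (x - y) * u0 y) + I \<omega>)\<^sup>2) \<partial>M)"
    using ae by (intro nn_integral_cong_AE) auto
  then show ?thesis using compensated_integral_second_moment[OF I] by simp
qed

locale superlinear_noise = levy_noise M mu N + stable_kernel \<nu> \<alpha> \<beta> p g
  for M :: "'w measure" and mu :: "'d::euclidean_space measure" and N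
    and \<nu> \<alpha> \<beta> :: real and p :: "real \<Rightarrow> 'd \<Rightarrow> real" and g +
  fixes \<sigma> :: "real \<Rightarrow> 'd \<Rightarrow> real" and u0 :: "'d \<Rightarrow> real" and J :: "'d \<Rightarrow> real"
    and L \<rho> \<kappa> :: real
  assumes dim: "\<beta> * DIM('d) / \<alpha> < 1"
    and u0: "u0 \<in> borel_measurable borel" "bounded (range u0)" "(INF x. u0 x) > 0"
    and pos: "L > 0" "\<rho> > 1" "\<kappa> > 0"
    and J: "J \<in> borel_measurable borel" "\<And>h. J h > 0"
    and \<sigma>: "\<And>x h. \<bar>\<sigma> x h\<bar> \<ge> L * J h * \<bar>x\<bar> powr \<rho>"
    and \<kappa>: "(\<integral>\<^sup>+h. ennreal ((J h)\<^sup>2) \<partial>mu) \<ge> ennreal \<kappa>"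
begin

text \<open>Only the times in the window from \<open>t - d\<close> to \<open>t\<close> are kept.
  They lie after \<open>T\<close>, so the bound \<open>A\<close> applies, and there
  \<open>(t - s) powr (- b)\<close> is at least \<open>d powr (- b)\<close>; the window length
  supplies the further factor \<open>d\<close>. The constant \<open>c\<close> is an assumption so
  that one value serves all steps.\<close>

lemma second_moment_step:
  assumes u: "mild_solution M mu N G \<sigma> u0 u" and meas: "\<And>t x. 0 < t \<Longrightarrow> u t x \<in> borel_measurable M"
    and c: "c > 0" "\<And>t. t > 0 \<Longrightarrow> ennreal (c * t powr (- (\<beta> * DIM('d) / \<alpha>))) \<le> (\<integral>\<^sup>+x. ennreal ((G t x)\<^sup>2) \<partial>lborel)"
    and A: "0 < A" and T: "0 \<le> T" and d: "0 < d"
    and le: "\<And>t x. T < t \<Longrightarrow> ennreal A \<le> (\<integral>\<^sup>+\<omega>. ennreal (\<bar>u t x \<omega>\<bar>\<^sup>2) \<partial>M)"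
    and t: "T + d < t"
  shows "ennreal ((L\<^sup>2 * \<kappa> * c) * A powr \<rho> * d powr (1 - \<beta> * DIM('d) / \<alpha>)) \<le> (\<integral>\<^sup>+\<omega>. ennreal (\<bar>u t x \<omega>\<bar>\<^sup>2) \<partial>M)"
proof -
  let ?b = "\<beta> * DIM('d) / \<alpha>"
  let ?C = "L\<^sup>2 * A powr \<rho>"
  have C: "0 \<le> ?C" by simp
  \<comment> \<open>The bound is carried outwards through the iterated integral: sample point, jump
    size, space, time.\<close>
  have omega: "ennreal ((G r z)\<^sup>2) * ennreal ?C * ennreal ((J h)\<^sup>2)
      \<le> (\<integral>\<^sup>+\<omega>. ennreal ((G r z * \<sigma> (u s y \<omega>) h)\<^sup>2) \<partial>M)" if s: "T < s" for r z s y h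
  proof -
    have um: "u s y \<in> borel_measurable M" using meas T s by simp
    let ?k = "(G r z)\<^sup>2 * L\<^sup>2 * (J h)\<^sup>2"
    have "ennreal ((G r z)\<^sup>2) * ennreal ?C * ennreal ((J h)\<^sup>2) = ennreal ?k * ennreal (A powr \<rho>)"
      by (simp add: mult_ac flip: ennreal_mult)
    also have "\<dots> \<le> ennreal ?k * (\<integral>\<^sup>+\<omega>. ennreal ((\<bar>u s y \<omega>\<bar> powr \<rho>)\<^sup>2) \<partial>M)"
      by (intro mult_left_mono second_moment_powr um A pos le s) simp
    also have "\<dots> = (\<integral>\<^sup>+\<omega>. ennreal ?k * ennreal ((\<bar>u s y \<omega>\<bar> powr \<rho>)\<^sup>2) \<partial>M)"
      using um by (intro nn_integral_cmult[symmetric]) measurable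
    also have "\<dots> \<le> (\<integral>\<^sup>+\<omega>. ennreal ((G r z * \<sigma> (u s y \<omega>) h)\<^sup>2) \<partial>M)"
    proof (rule nn_integral_mono)
      fix \<omega>
      have "(L * J h * \<bar>u s y \<omega>\<bar> powr \<rho>)\<^sup>2 \<le> \<bar>\<sigma> (u s y \<omega>) h\<bar>\<^sup>2"
        by (rule power_mono[OF \<sigma>]) (use pos J(2)[of h] in simp)
      then have "(G r z)\<^sup>2 * (L * J h * \<bar>u s y \<omega>\<bar> powr \<rho>)\<^sup>2 \<le> (G r z)\<^sup>2 * (\<sigma> (u s y \<omega>) h)\<^sup>2"
        by (intro mult_left_mono) auto
      then show "ennreal ?k * ennreal ((\<bar>u s y \<omega>\<bar> powr \<rho>)\<^sup>2) \<le> ennreal ((G r z * \<sigma> (u s y \<omega>) h)\<^sup>2)"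
        by (simp add: power_mult_distrib mult_ac ennreal_leI flip: ennreal_mult)
    qed
    finally show ?thesis .
  qed
  have jump: "ennreal ((G r z)\<^sup>2) * ennreal (?C * \<kappa>)
      \<le> (\<integral>\<^sup>+h. \<integral>\<^sup>+\<omega>. ennreal ((G r z * \<sigma> (u s y \<omega>) h)\<^sup>2) \<partial>M \<partial>mu)" if s: "T < s" for r z s y
  proof -
    have "ennreal ((G r z)\<^sup>2) * ennreal (?C * \<kappa>) = ennreal ((G r z)\<^sup>2) * ennreal ?C * ennreal \<kappa>"
      using pos by (simp add: mult_ac flip: ennreal_mult)
    also have "\<dots> \<le> ennreal ((G r z)\<^sup>2) * ennreal ?C * (\<integral>\<^sup>+h. ennreal ((J h)\<^sup>2) \<partial>mu)"
      by (intro mult_left_mono \<kappa>) simp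
    also have "\<dots> = (\<integral>\<^sup>+h. ennreal ((G r z)\<^sup>2) * ennreal ?C * ennreal ((J h)\<^sup>2) \<partial>mu)"
      using J(1) by (intro nn_integral_cmult[symmetric]) measurable
    also have "\<dots> \<le> (\<integral>\<^sup>+h. \<integral>\<^sup>+\<omega>. ennreal ((G r z * \<sigma> (u s y \<omega>) h)\<^sup>2) \<partial>M \<partial>mu)"
      by (intro nn_integral_mono omega s)
    finally show ?thesis .
  qed
  have space: "ennreal (c * d powr (- ?b) * (?C * \<kappa>))
      \<le> (\<integral>\<^sup>+y. \<integral>\<^sup>+h. \<integral>\<^sup>+\<omega>. ennreal ((G (t - s) (x - y) * \<sigma> (u s y \<omega>) h)\<^sup>2) \<partial>M \<partial>mu \<partial>lborel)"
    if s: "t - d < s" "s < t" for s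
  proof -
    have "d powr (- ?b) \<le> (t - s) powr (- ?b)"
      using s \<alpha> \<beta> by (intro powr_mono2') auto
    then have "ennreal (c * d powr (- ?b) * (?C * \<kappa>)) \<le> ennreal (c * (t - s) powr (- ?b) * (?C * \<kappa>))"
      using c pos by (intro ennreal_leI mult_right_mono mult_left_mono) auto
    also have "\<dots> = ennreal (c * (t - s) powr (- ?b)) * ennreal (?C * \<kappa>)"
      using c pos by (intro ennreal_mult) auto
    also have "\<dots> \<le> (\<integral>\<^sup>+y. ennreal ((G (t - s) y)\<^sup>2) \<partial>lborel) * ennreal (?C * \<kappa>)"
      by (intro mult_right_mono c) (use s in auto)
    also have "(\<integral>\<^sup>+y. ennreal ((G (t - s) y)\<^sup>2) \<partial>lborel) = (\<integral>\<^sup>+y. ennreal ((G (t - s) (x - y))\<^sup>2) \<partial>lborel)"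
      by (rule nn_integral_lborel_reflect[symmetric]) measurable
    also have "\<dots> * ennreal (?C * \<kappa>) = (\<integral>\<^sup>+y. ennreal ((G (t - s) (x - y))\<^sup>2) * ennreal (?C * \<kappa>) \<partial>lborel)"
      by (rule nn_integral_multc[symmetric]) measurable
    also have "\<dots> \<le> (\<integral>\<^sup>+y. \<integral>\<^sup>+h. \<integral>\<^sup>+\<omega>. ennreal ((G (t - s) (x - y) * \<sigma> (u s y \<omega>) h)\<^sup>2) \<partial>M \<partial>mu \<partial>lborel)"
      by (intro nn_integral_mono jump) (use s t in auto)
    finally show ?thesis .
  qed
  have "ennreal ((L\<^sup>2 * \<kappa> * c) * A powr \<rho> * d powr (1 - ?b)) = ennreal (c * d powr (- ?b) * (?C * \<kappa>) * d)"
    using d by (simp add: powr_diff powr_minus_divide mult_ac)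
  also have "\<dots> = ennreal (c * d powr (- ?b) * (?C * \<kappa>)) * emeasure lborel {t - d<..<t}"
    using c pos d by (simp add: ennreal_mult)
  also have "\<dots> = (\<integral>\<^sup>+s\<in>{t - d<..<t}. ennreal (c * d powr (- ?b) * (?C * \<kappa>)) \<partial>lborel)"
    by (rule nn_integral_cmult_indicator[symmetric]) simp
  also have "\<dots> \<le> integrand_sq_norm M mu t (\<lambda>s y h \<omega>. G (t - s) (x - y) * \<sigma> (u s y \<omega>) h)"
    unfolding integrand_sq_norm_def
    by (intro nn_integral_mono) (use space T t in \<open>auto split: split_indicator\<close>)
  also have "\<dots> \<le> ennreal ((LINT y|lborel. G t (x - y) * u0 y)\<^sup>2) + \<dots>" by simp
  also have "\<dots> \<le> (\<integral>\<^sup>+\<omega>. ennreal (\<bar>u t x \<omega>\<bar>\<^sup>2) \<partial>M)"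
    by (rule mild_solution_second_moment[OF u]) (use T d t in simp)
  finally show ?thesis .
qed

lemma second_moment_initial:
  assumes u: "mild_solution M mu N G \<sigma> u0 u" and t: "0 < t"
  shows "ennreal ((INF x. u0 x)\<^sup>2) \<le> (\<integral>\<^sup>+\<omega>. ennreal (\<bar>u t x \<omega>\<bar>\<^sup>2) \<partial>M)"
proof -
  \<comment> \<open>A real infimum is known to be a lower bound only for a set bounded below, which
    \<open>bounded (range u0)\<close> guarantees.\<close>
  have "(INF x. u0 x) \<le> u0 y" for y
    by (rule cINF_lower) (use u0 in \<open>auto intro: bounded_imp_bdd_below\<close>)
  then have "(INF x. u0 x)\<^sup>2 \<le> (LINT y|lborel. G t (x - y) * u0 y)\<^sup>2"
    using u0 by (intro power_mono kernel_average_ge[OF t u0(1,2)]) auto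
  then have "ennreal ((INF x. u0 x)\<^sup>2) \<le> ennreal ((LINT y|lborel. G t (x - y) * u0 y)\<^sup>2) +
      integrand_sq_norm M mu t (\<lambda>s y h \<omega>. G (t - s) (x - y) * \<sigma> (u s y \<omega>) h)"
    by (intro order_trans[OF ennreal_leI add_increasing2]) auto
  also have "\<dots> \<le> (\<integral>\<^sup>+\<omega>. ennreal (\<bar>u t x \<omega>\<bar>\<^sup>2) \<partial>M)"
    by (rule mild_solution_second_moment[OF u t])
  finally show ?thesis .
qed

lemma second_moment_blow_up:
  assumes u: "mild_solution M mu N G \<sigma> u0 u" and meas: "\<And>t x. 0 < t \<Longrightarrow> u t x \<in> borel_measurable M"
  shows "\<exists>T\<ge>0. \<forall>t>T. \<forall>x. (\<integral>\<^sup>+\<omega>. ennreal (\<bar>u t x \<omega>\<bar>\<^sup>2) \<partial>M) = \<infinity>"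
proof -
  obtain c where c: "c > 0"
    "\<And>t. t > 0 \<Longrightarrow> ennreal (c * t powr (- (\<beta> * DIM('d) / \<alpha>))) \<le> (\<integral>\<^sup>+x. ennreal ((G t x)\<^sup>2) \<partial>lborel)"
    using G_L2_lower_bound by blast
  show ?thesis
  proof (rule superlinear_blow_up)
    show "0 < L\<^sup>2 * \<kappa> * c" "1 < \<rho>" "0 < 1 - \<beta> * DIM('d) / \<alpha>" "0 < (INF x. u0 x)\<^sup>2"
      using pos c dim u0 by auto
  qed (use second_moment_initial[OF u] second_moment_step[OF u meas c] in blast)+
qed

theorem no_finite_energy_solution: "\<not> finite_energy_solution M mu N G \<sigma> u0 u"
proof
  assume "finite_energy_solution M mu N G \<sigma> u0 u"
  then obtain r where u: "mild_solution M mu N G \<sigma> u0 u"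
    and meas: "\<And>t x. 0 < t \<Longrightarrow> u t x \<in> borel_measurable M"
    and fin: "\<And>x. (\<integral>\<^sup>+t\<in>{0<..}. ennreal (exp (- r * t)) *
       (\<integral>\<^sup>+\<omega>. ennreal (\<bar>u t x \<omega>\<bar>\<^sup>2) \<partial>M) \<partial>lborel) < \<infinity>"
    unfolding finite_energy_solution_def in_field_space_def by blast
  obtain T where T: "T \<ge> 0" "\<And>t x. t > T \<Longrightarrow> (\<integral>\<^sup>+\<omega>. ennreal (\<bar>u t x \<omega>\<bar>\<^sup>2) \<partial>M) = \<infinity>"
    using second_moment_blow_up[OF u meas] by blast
  \<comment> \<open>The weight \<open>exp (- r * t)\<close> is positive, so an infinite second
    moment on a time interval of length 1 makes the energy at \<open>x = 0\<close> infinite for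
    every \<open>r\<close>.\<close>
  have "\<infinity> = \<infinity> * emeasure lborel {T<..<T + 1}" by (simp add: ennreal_mult_eq_top_iff)
  also have "\<dots> = (\<integral>\<^sup>+t\<in>{T<..<T + 1}. \<infinity> \<partial>lborel)"
    by (rule nn_integral_cmult_indicator[symmetric]) simp
  also have "\<dots> \<le> (\<integral>\<^sup>+t\<in>{0<..}. ennreal (exp (- r * t)) * (\<integral>\<^sup>+\<omega>. ennreal (\<bar>u t 0 \<omega>\<bar>\<^sup>2) \<partial>M) \<partial>lborel)"
    using T by (intro nn_integral_mono) (auto simp: ennreal_mult_eq_top_iff split: split_indicator)
  finally show False using fin[of 0] by simp
qed

end

theorem theorem2p4:
  fixes M :: "'w measure"
    and mu :: "'d::euclidean_space measure"
    and N :: "'w \<Rightarrow> (real \<times> 'd \<times> 'd) measure"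
    and p :: "real \<Rightarrow> 'd \<Rightarrow> real" and g :: "real \<Rightarrow> real"
    and \<sigma> :: "real \<Rightarrow> 'd \<Rightarrow> real" and u0 :: "'d \<Rightarrow> real" and J :: "'d \<Rightarrow> real"
    and \<alpha> \<beta> \<nu> L \<rho> \<kappa> :: real
  assumes "prob_space M"
    and "levy_measure mu"
    and "poisson_random_measure M (intensity mu) N"
    and "(\<lambda>(x, h). \<sigma> x h) \<in> borel_measurable (borel \<Otimes>\<^sub>M borel)"
    and "0 < \<alpha>" "\<alpha> \<le> 2" "0 < \<beta>" "\<beta> < 1" "0 < \<nu>"
    and "real DIM('d) < min 2 (1 / \<beta>) * \<alpha>"
    and "stable_density \<nu> \<alpha> p"
    and "subordinator_density \<beta> g"
    and "u0 \<in> borel_measurable borel" "bounded (range u0)" "(INF x. u0 x) > 0"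
    and "L > 0" "\<rho> > 1" "\<kappa> > 0"
    and "J \<in> borel_measurable borel" "\<And>h. J h > 0"
    and "\<And>x h. \<bar>\<sigma> x h\<bar> \<ge> L * J h * \<bar>x\<bar> powr \<rho>"
    and "(\<integral>\<^sup>+h. ennreal ((J h)\<^sup>2) \<partial>mu) \<ge> ennreal \<kappa>"
  shows "\<not> (\<exists>u. finite_energy_solution M mu N (kernel \<beta> p g) \<sigma> u0 u)"
proof -
  \<comment> \<open>A dimension below \<open>\<alpha> / \<beta>\<close> means that
    \<open>b = \<beta> * d / \<alpha>\<close> is below 1, that is, \<open>1 - b\<close> is
    positive.\<close>
  have "min 2 (1 / \<beta>) * \<alpha> \<le> 1 / \<beta> * \<alpha>"
    using \<open>0 < \<alpha>\<close> by (intro mult_right_mono) auto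
  then have "real DIM('d) < 1 / \<beta> * \<alpha>"
    using \<open>real DIM('d) < min 2 (1 / \<beta>) * \<alpha>\<close> by linarith
  then have dim: "\<beta> * DIM('d) / \<alpha> < 1"
    using \<open>0 < \<alpha>\<close> \<open>0 < \<beta>\<close> by (simp add: field_simps)
  interpret prob_space M by fact
  interpret superlinear_noise M mu N \<nu> \<alpha> \<beta> p g \<sigma> u0 J L \<rho> \<kappa>
    by unfold_locales (use assms dim in auto)
  show ?thesis using no_finite_energy_solution by blast
qed

end
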